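(* Let $u_0,\widetilde u_0\in L^2(\Omega;\mathbb H)$, and suppose there are constants $\alpha_{F,0},\alpha_{B,0}$ such that for all $u,v\in\mathbb H$: $\langle u-v,F(u)-F(v)\rangle_{\mathbb H}\le\alpha_{F,0}\|u-v\|_{\mathbb H}^2$ and $\|B(u)-B(v)\|_{HS(U_0;\mathbb H)}\le\alpha_{B,0}\|u-v\|_{\mathbb H}$. Let $\{u_k\}_{k\ge0}$ and $\{\widetilde u_k\}_{k\ge0}$ be the solutions of the semi-implicit Euler scheme with step-size $\Delta t$ and initial data $u_0$ and $\widetilde u_0$, respectively. If $\sigma_0>\alpha_{F,0}+\alpha_{B,0}^2$, then for sufficiently small $\Delta t>0$, $$\mathbb E\big[\|u_k-\widetilde u_k\|_{\mathbb H}^2\big]\le e^{-(\sigma_0-\alpha_{F,0}-\alpha_{B,0}^2)k\Delta t}\,\mathbb E\big[\|u_0-\widetilde u_0\|_{\mathbb H}^2\big]\qquad\forall\,k\in\mathbb N_+.$$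
   Context: Setting. $\Theta\subset\mathbb R^3$ is a bounded domain with unit outward normal $\mathbf n$, and $\mathbb H:=L^2(\Theta)^3\times L^2(\Theta)^3$ (real Hilbert space, usual inner product). The Maxwell operator is $M(\mathbf E,\mathbf H)=(\nabla\times\mathbf H,-\nabla\times\mathbf E)$ with domain $\mathcal D(M)=H_0(\mathrm{curl},\Theta)\times H(\mathrm{curl},\Theta)$, where $H(\mathrm{curl},\Theta)=\{v\in L^2(\Theta)^3:\nabla\times v\in L^2(\Theta)^3\}$ and $H_0(\mathrm{curl},\Theta)=\{v\in H(\mathrm{curl},\Theta):\mathbf n\times v|_{\partial\Theta}=\mathbf 0\}$; $M$ is skew-adjoint. $W(t)=\sum_{k\ge1}Q^{1/2}e_k\beta_k(t)$ is a $Q$-Wiener process on a filtered probability space $(\Omega,\mathcal F,\{\mathcal F_t\}_{t\ge0},\mathbb P)$, with $Q$ a symmetric positive definite operator on $L^2(\Theta)$, $\{e_k\}$ an orthonormal basis of $L^2(\Theta)$ and $\beta_k$ independent real Brownian motions; $U_0:=Q^{1/2}(L^2(\Theta))$; $HS$ denotes Hilbert--Schmidt operators. For given functions $\mathbf J_e,\mathbf J_m,\mathbf J_e^r,\mathbf J_m^r:\Theta\times\mathbb R^3\times\mathbb R^3\to\mathbb R^3$, the Nemytskij operators $F:\mathbb H\to\mathbb H$ and $B:\mathbb H\to HS(U_0;\mathbb H)$ are, for $h=(\mathbf h_1,\mathbf h_2)$ and $v\in U_0$, $F(h)(\mathbf x)=(-\mathbf J_e(\mathbf x,\mathbf h_1(\mathbf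 x),\mathbf h_2(\mathbf x)),-\mathbf J_m(\mathbf x,\mathbf h_1(\mathbf x),\mathbf h_2(\mathbf x)))$ and $(B(h)v)(\mathbf x)=(-\mathbf J_e^r(\mathbf x,\mathbf h_1(\mathbf x),\mathbf h_2(\mathbf x))v(\mathbf x),-\mathbf J_m^r(\mathbf x,\mathbf h_1(\mathbf x),\mathbf h_2(\mathbf x))v(\mathbf x))$. The semi-implicit Euler scheme with step-size $\Delta t>0$, $t_k=k\Delta t$, $\Delta W_k=W(t_{k+1})-W(t_k)$ and real constant $\sigma_0$, is $u_{k+1}-u_k=\Delta tMu_{k+1}-\sigma_0u_{k+1}\Delta t+\Delta tF(u_{k+1})+B(u_k)\Delta W_k$, $k\in\mathbb N$; solutions are $\{\mathcal F_{t_k}\}$-adapted and $\mathbb H$-valued. Initial data are $\mathcal F_0$-measurable. *)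

theory Defs
  imports "HOL-Probability.Probability"
begin

section \<open>Square-integrable functions on \<open>\<real>\<^sup>3\<close> modulo null sets\<close>

definition sq_integrable :: "(real ^ 3 \<Rightarrow> 'b::euclidean_space) \<Rightarrow> bool" where
  "sq_integrable f \<longleftrightarrow>
     f \<in> borel_measurable lebesgue \<and> integrable lebesgue (\<lambda>x. (norm (f x))\<^sup>2)"

definition L2_eq :: "(real ^ 3 \<Rightarrow> 'b::euclidean_space) \<Rightarrow> (real ^ 3 \<Rightarrow> 'b) \<Rightarrow> bool" where
  "L2_eq f g \<longleftrightarrow> sq_integrable f \<and> sq_integrable g \<and> (AE x in lebesgue. f x = g x)"

lemma sq_integrable_zero: "sq_integrable (\<lambda>x. 0)"
  by (simp add: sq_integrable_def)

lemma sq_integrable_add: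
  assumes "sq_integrable f" "sq_integrable g"
  shows "sq_integrable (\<lambda>x. f x + g x)"
proof -
  have [measurable]: "f \<in> borel_measurable lebesgue" "g \<in> borel_measurable lebesgue"
    using assms by (auto simp: sq_integrable_def)
  have "integrable lebesgue (\<lambda>x. 2 * (norm (f x))\<^sup>2 + 2 * (norm (g x))\<^sup>2)"
    using assms by (auto simp: sq_integrable_def)
  then have "integrable lebesgue (\<lambda>x. (norm (f x + g x))\<^sup>2)"
  proof (rule Bochner_Integration.integrable_bound)
    have "(norm (f x + g x))\<^sup>2 \<le> 2 * (norm (f x))\<^sup>2 + 2 * (norm (g x))\<^sup>2" for x
    proof -
      have "(norm (f x + g x))\<^sup>2 \<le> (norm (f x) + norm (g x))\<^sup>2"
        by (intro power_mono norm_triangle_ineq) auto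
      also have "\<dots> \<le> 2 * (norm (f x))\<^sup>2 + 2 * (norm (g x))\<^sup>2"
        using zero_le_power2[of "norm (f x) - norm (g x)"]
        by (simp add: power2_eq_square algebra_simps)
      finally show ?thesis .
    qed
    then show "AE x in lebesgue. norm ((norm (f x + g x))\<^sup>2)
        \<le> norm (2 * (norm (f x))\<^sup>2 + 2 * (norm (g x))\<^sup>2)"
      by (auto intro!: AE_I2 order_trans[OF _ abs_ge_self])
  qed measurable
  then show ?thesis
    by (simp add: sq_integrable_def)
qed

lemma sq_integrable_scaleR:
  assumes "sq_integrable f"
  shows "sq_integrable (\<lambda>x. c *\<^sub>R f x)"
  using assms by (auto simp: sq_integrable_def power_mult_distrib)

lemma sq_integrable_uminus: "sq_integrable f \<Longrightarrow> sq_integrable (\<lambda>x. - f x)"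
  using sq_integrable_scaleR[of f "-1"] by simp

lemma integrable_inner_sq:
  assumes "sq_integrable f" "sq_integrable g"
  shows "integrable lebesgue (\<lambda>x. f x \<bullet> g x)"
proof -
  have [measurable]: "f \<in> borel_measurable lebesgue" "g \<in> borel_measurable lebesgue"
    using assms by (auto simp: sq_integrable_def)
  have "integrable lebesgue (\<lambda>x. (norm (f x))\<^sup>2 + (norm (g x))\<^sup>2)"
    using assms by (auto simp: sq_integrable_def)
  then show ?thesis
  proof (rule Bochner_Integration.integrable_bound)
    have "\<bar>f x \<bullet> g x\<bar> \<le> (norm (f x))\<^sup>2 + (norm (g x))\<^sup>2" for x
    proof -
      have "\<bar>f x \<bullet> g x\<bar> \<le> norm (f x) * norm (g x)"
        by (rule Cauchy_Schwarz_ineq2)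
      also have "\<dots> \<le> 2 * norm (f x) * norm (g x)"
        by simp
      also have "\<dots> \<le> (norm (f x))\<^sup>2 + (norm (g x))\<^sup>2"
        by (rule sum_squares_bound)
      finally show ?thesis .
    qed
    then show "AE x in lebesgue. norm (f x \<bullet> g x)
        \<le> norm ((norm (f x))\<^sup>2 + (norm (g x))\<^sup>2)"
      by (auto intro!: AE_I2 order_trans[OF _ abs_ge_self])
  qed measurable
qed

quotient_type (overloaded) 'b L2 = "real ^ 3 \<Rightarrow> 'b::euclidean_space" / partial: L2_eq
proof (rule part_equivpI)
  show "\<exists>f. L2_eq f f"
    using sq_integrable_zero by (auto simp: L2_eq_def)
  show "symp L2_eq"
    by (auto simp: symp_def L2_eq_def)
  show "transp L2_eq"
    unfolding transp_def L2_eq_def by (auto elim: AE_mp)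
qed

instantiation L2 :: (euclidean_space) real_inner
begin

lift_definition zero_L2 :: "'a L2" is "\<lambda>x. 0"
  by (simp add: L2_eq_def sq_integrable_zero)

lift_definition plus_L2 :: "'a L2 \<Rightarrow> 'a L2 \<Rightarrow> 'a L2" is "\<lambda>f g x. f x + g x"
  unfolding L2_eq_def by (auto intro: sq_integrable_add)

lift_definition uminus_L2 :: "'a L2 \<Rightarrow> 'a L2" is "\<lambda>f x. - f x"
  unfolding L2_eq_def by (auto intro: sq_integrable_uminus)

lift_definition scaleR_L2 :: "real \<Rightarrow> 'a L2 \<Rightarrow> 'a L2" is "\<lambda>c f x. c *\<^sub>R f x"
  unfolding L2_eq_def by (auto intro: sq_integrable_scaleR)

lift_definition inner_L2 :: "'a L2 \<Rightarrow> 'a L2 \<Rightarrow> real"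
  is "\<lambda>f g. LINT x|lebesgue. f x \<bullet> g x"
proof -
  fix f f' g g' :: "real ^ 3 \<Rightarrow> 'a"
  assume *: "L2_eq f f'" "L2_eq g g'"
  then have "AE x in lebesgue. f x \<bullet> g x = f' x \<bullet> g' x"
    unfolding L2_eq_def by auto
  moreover have "integrable lebesgue (\<lambda>x. f x \<bullet> g x)" "integrable lebesgue (\<lambda>x. f' x \<bullet> g' x)"
    using * by (auto simp: L2_eq_def intro: integrable_inner_sq)
  ultimately show "(LINT x|lebesgue. f x \<bullet> g x) = (LINT x|lebesgue. f' x \<bullet> g' x)"
    by (intro integral_cong_AE) (auto intro: borel_measurable_integrable)
qed

definition minus_L2 :: "'a L2 \<Rightarrow> 'a L2 \<Rightarrow> 'a L2" where
  "minus_L2 f g = f + - g"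

definition norm_L2 :: "'a L2 \<Rightarrow> real" where
  "norm_L2 f = sqrt (f \<bullet> f)"

definition sgn_L2 :: "'a L2 \<Rightarrow> 'a L2" where
  "sgn_L2 f = inverse (norm f) *\<^sub>R f"

definition dist_L2 :: "'a L2 \<Rightarrow> 'a L2 \<Rightarrow> real" where
  "dist_L2 f g = norm (f - g)"

definition uniformity_L2 :: "('a L2 \<times> 'a L2) filter" where
  "uniformity_L2 = (INF e\<in>{0<..}. principal {(x, y). dist x y < e})"

definition open_L2 :: "'a L2 set \<Rightarrow> bool" where
  "open_L2 U \<longleftrightarrow> (\<forall>x\<in>U. eventually (\<lambda>(x', y). x' = x \<longrightarrow> y \<in> U) uniformity)"

instance
proof
  fix a b c :: "'a L2" and r s :: real and U :: "'a L2 set"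
  show "a + b + c = a + (b + c)"
    by transfer (auto simp: L2_eq_def add.assoc intro!: sq_integrable_add)
  show "a + b = b + a"
    by transfer (auto simp: L2_eq_def add.commute intro!: sq_integrable_add)
  show "0 + a = a"
    by transfer (auto simp: L2_eq_def)
  show "- a + a = 0"
    by transfer (auto simp: L2_eq_def sq_integrable_zero)
  show "a - b = a + - b"
    by (simp add: minus_L2_def)
  show "r *\<^sub>R (a + b) = r *\<^sub>R a + r *\<^sub>R b"
    by transfer (auto simp: L2_eq_def scaleR_add_right
        intro!: sq_integrable_add sq_integrable_scaleR)
  show "(r + s) *\<^sub>R a = r *\<^sub>R a + s *\<^sub>R a"
    by transfer (auto simp: L2_eq_def scaleR_add_left
        intro!: sq_integrable_add sq_integrable_scaleR)
  show "r *\<^sub>R s *\<^sub>R a = (r * s) *\<^sub>R a"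
    by transfer (auto simp: L2_eq_def intro!: sq_integrable_scaleR)
  show "1 *\<^sub>R a = a"
    by transfer (auto simp: L2_eq_def)
  show "sgn a = inverse (norm a) *\<^sub>R a"
    by (simp add: sgn_L2_def)
  show "dist a b = norm (a - b)"
    by (simp add: dist_L2_def)
  show "(uniformity :: ('a L2 \<times> 'a L2) filter) = (INF e\<in>{0<..}. principal {(x, y). dist x y < e})"
    by (simp add: uniformity_L2_def)
  show "open U \<longleftrightarrow> (\<forall>x\<in>U. eventually (\<lambda>(x', y). x' = x \<longrightarrow> y \<in> U) uniformity)"
    by (simp add: open_L2_def)
  show "a \<bullet> b = b \<bullet> a"
    by transfer (simp add: inner_commute)
  show "(a + b) \<bullet> c = a \<bullet> c + b \<bullet> c"
    by transfer (simp add: inner_add_left L2_eq_def integrable_inner_sq)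
  show "(r *\<^sub>R a) \<bullet> b = r * (a \<bullet> b)"
    by transfer simp
  show "0 \<le> a \<bullet> a"
    by transfer simp
  show "a \<bullet> a = 0 \<longleftrightarrow> a = 0"
  proof transfer
    fix f :: "real ^ 3 \<Rightarrow> 'a"
    assume f: "L2_eq f f"
    then have "(LINT x|lebesgue. f x \<bullet> f x) = 0 \<longleftrightarrow> (AE x in lebesgue. f x \<bullet> f x = 0)"
      by (intro integral_nonneg_eq_0_iff_AE) (auto simp: L2_eq_def integrable_inner_sq)
    then show "(LINT x|lebesgue. f x \<bullet> f x) = 0 \<longleftrightarrow> L2_eq f (\<lambda>x. 0)"
      using f by (simp add: L2_eq_def sq_integrable_zero)
  qed
  show "norm a = sqrt (a \<bullet> a)"
    by (simp add: norm_L2_def)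
qed

end

text \<open>
  \<open>L\<^sup>2(\<Theta>)\<close> is the closed subspace of those classes on \<open>\<real>\<^sup>3\<close> which vanish almost everywhere outside
  \<open>\<Theta>\<close> (extension by zero); inner product and norm are those inherited from \<open>L\<^sup>2(\<real>\<^sup>3)\<close>.
\<close>

definition L2_on :: "(real ^ 3) set \<Rightarrow> 'b::euclidean_space L2 set" where
  "L2_on \<Theta> = {v. AE x in lebesgue. x \<notin> \<Theta> \<longrightarrow> rep_L2 v x = 0}"

type_synonym EM = "(real ^ 3) L2 \<times> (real ^ 3) L2"

definition \<HH> :: "(real ^ 3) set \<Rightarrow> EM set" where
  "\<HH> \<Theta> = L2_on \<Theta> \<times> L2_on \<Theta>"

section \<open>The Maxwell operator\<close>

definition pderiv3 :: "3 \<Rightarrow> (real ^ 3 \<Rightarrow> real ^ 3) \<Rightarrow> real ^ 3 \<Rightarrow> real ^ 3" where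
  "pderiv3 i f x = frechet_derivative f (at x) (axis i 1)"

fun iterated_pderiv :: "3 list \<Rightarrow> (real ^ 3 \<Rightarrow> real ^ 3) \<Rightarrow> real ^ 3 \<Rightarrow> real ^ 3" where
  "iterated_pderiv [] f = f"
| "iterated_pderiv (i # is) f = pderiv3 i (iterated_pderiv is f)"

definition smooth3 :: "(real ^ 3 \<Rightarrow> real ^ 3) \<Rightarrow> bool" where
  "smooth3 f \<longleftrightarrow> (\<forall>is x. iterated_pderiv is f differentiable (at x))"

definition test_fields :: "(real ^ 3) set \<Rightarrow> (real ^ 3 \<Rightarrow> real ^ 3) set" where
  "test_fields \<Theta> =
     {\<phi>. smooth3 \<phi> \<and> compact (closure {x. \<phi> x \<noteq> 0}) \<and> closure {x. \<phi> x \<noteq> 0} \<subseteq> \<Theta>}"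

definition classical_curl :: "(real ^ 3 \<Rightarrow> real ^ 3) \<Rightarrow> real ^ 3 \<Rightarrow> real ^ 3" where
  "classical_curl \<phi> x = vector
     [pderiv3 2 \<phi> x $ 3 - pderiv3 3 \<phi> x $ 2,
      pderiv3 3 \<phi> x $ 1 - pderiv3 1 \<phi> x $ 3,
      pderiv3 1 \<phi> x $ 2 - pderiv3 2 \<phi> x $ 1]"

definition weak_curl :: "(real ^ 3) set \<Rightarrow> (real ^ 3) L2 \<Rightarrow> (real ^ 3) L2 \<Rightarrow> bool" where
  "weak_curl \<Theta> v w \<longleftrightarrow> w \<in> L2_on \<Theta> \<and>
     (\<forall>\<phi>\<in>test_fields \<Theta>.
        (LINT x:\<Theta>|lebesgue. rep_L2 v x \<bullet> classical_curl \<phi> x) =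
        (LINT x:\<Theta>|lebesgue. rep_L2 w x \<bullet> \<phi> x))"

definition H_curl :: "(real ^ 3) set \<Rightarrow> (real ^ 3) L2 set" where
  "H_curl \<Theta> = {v \<in> L2_on \<Theta>. \<exists>w. weak_curl \<Theta> v w}"

definition curl :: "(real ^ 3) set \<Rightarrow> (real ^ 3) L2 \<Rightarrow> (real ^ 3) L2" where
  "curl \<Theta> v = (THE w. weak_curl \<Theta> v w)"

text \<open>
  For \<open>v \<in> H(curl,\<Theta>)\<close> the trace \<open>n \<times> v\<close> on the boundary is not a function; as usual it is the
  functional given by Green's formula
  \<open>\<integral>\<^bsub>\<partial>\<Theta>\<^esub> (n \<times> v) \<cdot> \<phi> dS = \<integral>\<^bsub>\<Theta>\<^esub> (curl v \<cdot> \<phi> - v \<cdot> curl \<phi>) dx\<close>, acting on \<open>\<phi> \<in> H(curl,\<Theta>)\<close>.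
  With \<open>H_curl0\<close> its kernel, the pair \<open>H_curl0 \<times> H_curl\<close> is the domain of a skew-adjoint operator
  for every open \<open>\<Theta>\<close>, and no other first factor has this property.
\<close>

definition tangential_trace :: "(real ^ 3) set \<Rightarrow> (real ^ 3) L2 \<Rightarrow> (real ^ 3) L2 \<Rightarrow> real" where
  "tangential_trace \<Theta> v \<phi> = curl \<Theta> v \<bullet> \<phi> - v \<bullet> curl \<Theta> \<phi>"

definition H_curl0 :: "(real ^ 3) set \<Rightarrow> (real ^ 3) L2 set" where
  "H_curl0 \<Theta> = {v \<in> H_curl \<Theta>. \<forall>\<phi>\<in>H_curl \<Theta>. tangential_trace \<Theta> v \<phi> = 0}"

definition Maxwell_dom :: "(real ^ 3) set \<Rightarrow> EM set" where
  "Maxwell_dom \<Theta> = H_curl0 \<Theta> \<times> H_curl \<Theta>"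

definition Maxwell :: "(real ^ 3) set \<Rightarrow> EM \<Rightarrow> EM" where
  "Maxwell \<Theta> u = (curl \<Theta> (snd u), - curl \<Theta> (fst u))"

section \<open>Operators on \<open>L\<^sup>2(\<Theta>)\<close> and Hilbert--Schmidt operators\<close>

definition symmetric_op_on :: "'a::real_inner set \<Rightarrow> ('a \<Rightarrow> 'a) \<Rightarrow> bool" where
  "symmetric_op_on V A \<longleftrightarrow>
     (\<forall>v\<in>V. A v \<in> V) \<and>
     (\<forall>v\<in>V. \<forall>w\<in>V. A (v + w) = A v + A w) \<and>
     (\<forall>c. \<forall>v\<in>V. A (c *\<^sub>R v) = c *\<^sub>R A v) \<and>
     (\<exists>C. \<forall>v\<in>V. norm (A v) \<le> C * norm v) \<and>
     (\<forall>v\<in>V. \<forall>w\<in>V. A v \<bullet> w = v \<bullet> A w)"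

definition pos_def_op_on :: "'a::real_inner set \<Rightarrow> ('a \<Rightarrow> 'a) \<Rightarrow> bool" where
  "pos_def_op_on V A \<longleftrightarrow> symmetric_op_on V A \<and> (\<forall>v\<in>V. v \<noteq> 0 \<longrightarrow> 0 < A v \<bullet> v)"

text \<open>The positive square root; on \<open>V\<close> it is uniquely determined when \<open>V\<close> is a Hilbert space.\<close>

definition is_sqrt_op_on :: "'a::real_inner set \<Rightarrow> ('a \<Rightarrow> 'a) \<Rightarrow> ('a \<Rightarrow> 'a) \<Rightarrow> bool" where
  "is_sqrt_op_on V A R \<longleftrightarrow>
     symmetric_op_on V R \<and> (\<forall>v\<in>V. 0 \<le> R v \<bullet> v) \<and> (\<forall>v\<in>V. R (R v) = A v)"

definition orthonormal_basis_of :: "'a::real_inner set \<Rightarrow> (nat \<Rightarrow> 'a) \<Rightarrow> bool" where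
  "orthonormal_basis_of V e \<longleftrightarrow>
     (\<forall>i j. e i \<bullet> e j = (if i = j then 1 else 0)) \<and> closure (span (range e)) = V"

text \<open>
  \<open>U\<^sub>0 = Q\<^sup>1\<^sup>/\<^sup>2(L\<^sup>2(\<Theta>))\<close> carries the norm \<open>\<parallel>R w\<parallel> = \<parallel>w\<parallel>\<close> with \<open>R = Q\<^sup>1\<^sup>/\<^sup>2\<close> injective, so \<open>(R e\<^sub>j)\<^sub>j\<close> is an orthonormal
  basis of \<open>U\<^sub>0\<close> whenever \<open>e\<close> is one of \<open>L\<^sup>2(\<Theta>)\<close>; the Hilbert--Schmidt norm does not depend on it.
\<close>

definition U0 :: "(real ^ 3) set \<Rightarrow> (real L2 \<Rightarrow> real L2) \<Rightarrow> real L2 set" where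
  "U0 \<Theta> R = R ` L2_on \<Theta>"

definition HS_norm ::
  "(real L2 \<Rightarrow> real L2) \<Rightarrow> (nat \<Rightarrow> real L2) \<Rightarrow> (real L2 \<Rightarrow> EM) \<Rightarrow> real" where
  "HS_norm R e G = sqrt (\<Sum>j. (norm (G (R (e j))))\<^sup>2)"

definition HS ::
  "(real ^ 3) set \<Rightarrow> (real L2 \<Rightarrow> real L2) \<Rightarrow> (nat \<Rightarrow> real L2) \<Rightarrow> (real L2 \<Rightarrow> EM) set" where
  "HS \<Theta> R e = {G.
     (\<forall>v\<in>U0 \<Theta> R. G v \<in> \<HH> \<Theta>) \<and>
     (\<forall>v\<in>U0 \<Theta> R. \<forall>w\<in>U0 \<Theta> R. G (v + w) = G v + G w) \<and>
     (\<forall>c. \<forall>v\<in>U0 \<Theta> R. G (c *\<^sub>R v) = c *\<^sub>R G v) \<and>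
     (\<exists>C. \<forall>w\<in>L2_on \<Theta>. norm (G (R w)) \<le> C * norm w) \<and>
     summable (\<lambda>j. (norm (G (R (e j))))\<^sup>2)}"

section \<open>Nemytskij operators\<close>

definition drift_field ::
  "(real ^ 3) set \<Rightarrow> (real ^ 3 \<Rightarrow> real ^ 3 \<Rightarrow> real ^ 3 \<Rightarrow> real ^ 3) \<Rightarrow> EM \<Rightarrow> real ^ 3 \<Rightarrow> real ^ 3" where
  "drift_field \<Theta> J h x =
     (if x \<in> \<Theta> then - J x (rep_L2 (fst h) x) (rep_L2 (snd h) x) else 0)"

definition noise_field ::
  "(real ^ 3) set \<Rightarrow> (real ^ 3 \<Rightarrow> real ^ 3 \<Rightarrow> real ^ 3 \<Rightarrow> real ^ 3) \<Rightarrow> EM \<Rightarrow> real L2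
     \<Rightarrow> real ^ 3 \<Rightarrow> real ^ 3" where
  "noise_field \<Theta> J h v x = rep_L2 v x *\<^sub>R drift_field \<Theta> J h x"

definition Nemytskij_F ::
  "(real ^ 3) set \<Rightarrow> (real ^ 3 \<Rightarrow> real ^ 3 \<Rightarrow> real ^ 3 \<Rightarrow> real ^ 3)
     \<Rightarrow> (real ^ 3 \<Rightarrow> real ^ 3 \<Rightarrow> real ^ 3 \<Rightarrow> real ^ 3) \<Rightarrow> EM \<Rightarrow> EM" where
  "Nemytskij_F \<Theta> Je Jm h = (abs_L2 (drift_field \<Theta> Je h), abs_L2 (drift_field \<Theta> Jm h))"

definition Nemytskij_B ::
  "(real ^ 3) set \<Rightarrow> (real ^ 3 \<Rightarrow> real ^ 3 \<Rightarrow> real ^ 3 \<Rightarrow> real ^ 3)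
     \<Rightarrow> (real ^ 3 \<Rightarrow> real ^ 3 \<Rightarrow> real ^ 3 \<Rightarrow> real ^ 3) \<Rightarrow> EM \<Rightarrow> real L2 \<Rightarrow> EM" where
  "Nemytskij_B \<Theta> Jer Jmr h v = (abs_L2 (noise_field \<Theta> Jer h v), abs_L2 (noise_field \<Theta> Jmr h v))"

text \<open>
  \<open>abs_L2\<close> is meaningful only on square-integrable functions, so that \<open>F\<close> maps \<open>\<HH>\<close> into \<open>\<HH>\<close> and \<open>B\<close>
  maps \<open>\<HH>\<close> into the Hilbert--Schmidt operators has to say that the fields are square-integrable.
\<close>

definition F_well_defined ::
  "(real ^ 3) set \<Rightarrow> (real ^ 3 \<Rightarrow> real ^ 3 \<Rightarrow> real ^ 3 \<Rightarrow> real ^ 3)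
     \<Rightarrow> (real ^ 3 \<Rightarrow> real ^ 3 \<Rightarrow> real ^ 3 \<Rightarrow> real ^ 3) \<Rightarrow> bool" where
  "F_well_defined \<Theta> Je Jm \<longleftrightarrow>
     (\<forall>h\<in>\<HH> \<Theta>. sq_integrable (drift_field \<Theta> Je h) \<and> sq_integrable (drift_field \<Theta> Jm h))"

definition B_well_defined ::
  "(real ^ 3) set \<Rightarrow> (real L2 \<Rightarrow> real L2) \<Rightarrow> (nat \<Rightarrow> real L2)
     \<Rightarrow> (real ^ 3 \<Rightarrow> real ^ 3 \<Rightarrow> real ^ 3 \<Rightarrow> real ^ 3)
     \<Rightarrow> (real ^ 3 \<Rightarrow> real ^ 3 \<Rightarrow> real ^ 3 \<Rightarrow> real ^ 3) \<Rightarrow> bool" where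
  "B_well_defined \<Theta> R e Jer Jmr \<longleftrightarrow>
     (\<forall>h\<in>\<HH> \<Theta>.
        (\<forall>v\<in>U0 \<Theta> R. sq_integrable (noise_field \<Theta> Jer h v) \<and> sq_integrable (noise_field \<Theta> Jmr h v)) \<and>
        Nemytskij_B \<Theta> Jer Jmr h \<in> HS \<Theta> R e)"

section \<open>The driving noise\<close>

definition filtration_on :: "'w measure \<Rightarrow> (real \<Rightarrow> 'w measure) \<Rightarrow> bool" where
  "filtration_on P \<F> \<longleftrightarrow>
     (\<forall>t\<ge>0. subalgebra P (\<F> t)) \<and> (\<forall>s\<ge>0. \<forall>t\<ge>s. sets (\<F> s) \<subseteq> sets (\<F> t))"

text \<open>
  Independent standard Brownian motions relative to \<open>\<F>\<close>: the processes are mutually independent, as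
  random elements of the path space, and the whole sequence of increments after time \<open>s\<close> is
  independent of \<open>\<F>\<^sub>s\<close>.
\<close>

definition independent_Brownian_motions ::
  "'w measure \<Rightarrow> (real \<Rightarrow> 'w measure) \<Rightarrow> (nat \<Rightarrow> real \<Rightarrow> 'w \<Rightarrow> real) \<Rightarrow> bool" where
  "independent_Brownian_motions P \<F> \<beta> \<longleftrightarrow>
     (\<forall>j. \<forall>t\<ge>0. \<beta> j t \<in> borel_measurable (\<F> t)) \<and>
     (\<forall>j. AE \<omega> in P. \<beta> j 0 \<omega> = 0) \<and>
     (\<forall>j. AE \<omega> in P. continuous_on {0..} (\<lambda>t. \<beta> j t \<omega>)) \<and>
     (\<forall>j. \<forall>s\<ge>0. \<forall>t>s.
        distributed P lborel (\<lambda>\<omega>. \<beta> j t \<omega> - \<beta> j s \<omega>) (normal_density 0 (sqrt (t - s)))) \<and>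
     prob_space.indep_vars P (\<lambda>_. PiM {0..} (\<lambda>_. borel))
        (\<lambda>j \<omega>. \<lambda>t\<in>{0..}. \<beta> j t \<omega>) UNIV \<and>
     (\<forall>s\<ge>0. \<forall>t\<ge>s. prob_space.indep_set P (sets (\<F> s))
        (sets (vimage_algebra (space P) (\<lambda>\<omega> j. \<beta> j t \<omega> - \<beta> j s \<omega>) (PiM UNIV (\<lambda>_. borel)))))"

definition converges_in_probability ::
  "'w measure \<Rightarrow> (nat \<Rightarrow> 'w \<Rightarrow> 'a::metric_space) \<Rightarrow> ('w \<Rightarrow> 'a) \<Rightarrow> bool" where
  "converges_in_probability P X Y \<longleftrightarrow>
     (\<forall>\<epsilon>>0. (\<lambda>n. measure P {\<omega> \<in> space P. \<epsilon> < dist (X n \<omega>) (Y \<omega>)}) \<longlonglongrightarrow> 0)"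

text \<open>
  \<open>noise_term P R e \<beta> s t G Y\<close> says \<open>Y = G (W(t) - W(s))\<close> for a random Hilbert--Schmidt operator \<open>G\<close>
  on \<open>U\<^sub>0\<close> and \<open>W(t) = \<Sum>\<^sub>j R e\<^sub>j \<beta>\<^sub>j(t)\<close>. Since \<open>W(t)\<close> lies almost surely outside \<open>U\<^sub>0\<close>, where \<open>G\<close> is defined,
  this is, as always for the stochastic integral of \<open>G\<close> over \<open>(s, t]\<close>, the limit in probability of
  \<open>G\<close> applied to the partial sums of \<open>W(t) - W(s)\<close>.
\<close>

definition noise_term ::
  "'w measure \<Rightarrow> (real L2 \<Rightarrow> real L2) \<Rightarrow> (nat \<Rightarrow> real L2) \<Rightarrow> (nat \<Rightarrow> real \<Rightarrow> 'w \<Rightarrow> real)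
     \<Rightarrow> real \<Rightarrow> real \<Rightarrow> ('w \<Rightarrow> real L2 \<Rightarrow> EM) \<Rightarrow> ('w \<Rightarrow> EM) \<Rightarrow> bool" where
  "noise_term P R e \<beta> s t G Y \<longleftrightarrow>
     Y \<in> borel_measurable P \<and>
     converges_in_probability P
       (\<lambda>n \<omega>. G \<omega> (\<Sum>j<n. (\<beta> j t \<omega> - \<beta> j s \<omega>) *\<^sub>R R (e j))) Y"

section \<open>The semi-implicit Euler scheme\<close>

definition L2_initial :: "'w measure \<Rightarrow> (real \<Rightarrow> 'w measure) \<Rightarrow> (real ^ 3) set \<Rightarrow> ('w \<Rightarrow> EM) \<Rightarrow> bool" where
  "L2_initial P \<F> \<Theta> u0 \<longleftrightarrow>
     u0 \<in> borel_measurable (\<F> 0) \<and> (\<forall>\<omega>\<in>space P. u0 \<omega> \<in> \<HH> \<Theta>) \<and>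
     integrable P (\<lambda>\<omega>. (norm (u0 \<omega>))\<^sup>2)"

definition Euler_solution ::
  "'w measure \<Rightarrow> (real \<Rightarrow> 'w measure) \<Rightarrow> (real L2 \<Rightarrow> real L2) \<Rightarrow> (nat \<Rightarrow> real L2)
     \<Rightarrow> (nat \<Rightarrow> real \<Rightarrow> 'w \<Rightarrow> real) \<Rightarrow> (real ^ 3) set \<Rightarrow> (EM \<Rightarrow> EM) \<Rightarrow> (EM \<Rightarrow> real L2 \<Rightarrow> EM)
     \<Rightarrow> real \<Rightarrow> real \<Rightarrow> ('w \<Rightarrow> EM) \<Rightarrow> (nat \<Rightarrow> 'w \<Rightarrow> EM) \<Rightarrow> bool" where
  "Euler_solution P \<F> R e \<beta> \<Theta> F B \<sigma>\<^sub>0 \<Delta>t u0 u \<longleftrightarrow>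
     (AE \<omega> in P. u 0 \<omega> = u0 \<omega>) \<and>
     (\<forall>k. u k \<in> borel_measurable (\<F> (real k * \<Delta>t))) \<and>
     (\<forall>k. \<forall>\<omega>\<in>space P. u k \<omega> \<in> \<HH> \<Theta>) \<and>
     (\<forall>k. \<exists>Y. noise_term P R e \<beta> (real k * \<Delta>t) (real (Suc k) * \<Delta>t) (\<lambda>\<omega>. B (u k \<omega>)) Y \<and>
        (AE \<omega> in P. u (Suc k) \<omega> \<in> Maxwell_dom \<Theta> \<and>
           u (Suc k) \<omega> - u k \<omega> =
             \<Delta>t *\<^sub>R Maxwell \<Theta> (u (Suc k) \<omega>) - (\<sigma>\<^sub>0 * \<Delta>t) *\<^sub>R u (Suc k) \<omega>
             + \<Delta>t *\<^sub>R F (u (Suc k) \<omega>) + Y \<omega>))"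

end

theory Submission
  imports Defs
begin

text \<open>
  Let \<open>z\<^sub>k\<close> be the difference of the two solutions and \<open>D\<^sub>k\<close> that of their noise terms. Testing the
  difference of the schemes with \<open>z\<^sub>k\<^sub>+\<^sub>1\<close>, skewness of the Maxwell operator and monotonicity of \<open>F\<close> give
  \<open>(1 + a \<Delta>t) \<parallel>z\<^sub>k\<^sub>+\<^sub>1\<parallel> \<le> \<parallel>z\<^sub>k + D\<^sub>k\<parallel>\<close> with \<open>a = \<sigma>\<^sub>0 - \<alpha>F\<close>. The Brownian increments are centred,
  uncorrelated and independent of the past, so for the partial sums of the noise, and by Fatou's
  lemma along an almost surely convergent subsequence also for \<open>D\<^sub>k\<close>,
  \<open>E \<parallel>z\<^sub>k + D\<^sub>k\<parallel>\<^sup>2 \<le> (1 + \<alpha>B\<^sup>2 \<Delta>t) E \<parallel>z\<^sub>k\<parallel>\<^sup>2\<close>. Finally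
  \<open>(1 + \<alpha>B\<^sup>2 \<Delta>t) / (1 + a \<Delta>t)\<^sup>2 \<le> exp (- (a - \<alpha>B\<^sup>2) \<Delta>t)\<close> as long as \<open>a \<Delta>t \<le> 1\<close>.
\<close>

subsection \<open>Orthonormal expansions and measurability of inner products\<close>

text \<open>Bessel's inequality makes the partial sums \<open>p n\<close> contractions. The vectors
  \<open>v\<close> with \<open>p n v\<close> tending to \<open>v\<close> form a subspace containing
  the span, and contractivity carries the convergence over to its closure.\<close>

lemma inner_sums_orthonormal:
  fixes e :: "nat \<Rightarrow> 'a::real_inner"
  assumes orth: "\<And>i j. e i \<bullet> e j = (if i = j then 1 else 0)"
    and x: "x \<in> closure (span (range e))"
  shows "(\<lambda>j. (x \<bullet> e j) * (y \<bullet> e j)) sums (x \<bullet> y)"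
proof -
  define p where "p n v = (\<Sum>j<n. (v \<bullet> e j) *\<^sub>R e j)" for n v
  have p_diff: "p n (v - w) = p n v - p n w" for n v w
    by (simp add: p_def inner_diff_left scaleR_diff_left sum_subtractf)
  have p_inner: "p n v \<bullet> w = (\<Sum>j<n. (v \<bullet> e j) * (w \<bullet> e j))" for n v w
    by (simp add: p_def inner_sum_left inner_commute[of w])
  have p_norm: "norm (p n v) \<le> norm v" for n v
  proof -
    \<comment> \<open>The first \<open>n\<close> coefficients of \<open>p n v\<close> are those of
      \<open>v\<close>, so \<open>p n v\<close> has the same inner product with itself as with
      \<open>v\<close>, and Cauchy-Schwarz applies.\<close>
    have "p n v \<bullet> e i = v \<bullet> e i" if "i < n" for i
      using that by (simp add: p_inner orth if_distrib cong: if_cong)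
    then have "p n v \<bullet> p n v = p n v \<bullet> v"
      unfolding p_inner[of n "p n v"] p_inner[of n v] by (intro sum.cong) auto
    then have "norm (p n v) * norm (p n v) \<le> norm (p n v) * norm v"
      by (metis norm_cauchy_schwarz power2_eq_square power2_norm_eq_inner)
    then show ?thesis
      by (cases "norm (p n v) = 0") (auto simp: mult_le_cancel_left_pos)
  qed
  define V where "V = {v. (\<lambda>n. p n v) \<longlonglongrightarrow> v}"
  have "subspace V"
    unfolding subspace_def V_def p_def
    by (auto simp: inner_add_left scaleR_add_left sum.distrib tendsto_add
        scaleR_sum_right[symmetric] scaleR_scaleR[symmetric] tendsto_scaleR simp del: scaleR_scaleR)
  moreover have "range e \<subseteq> V"
  proof clarify
    fix i
    have "p n (e i) = e i" if "n > i" for n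
      using that by (simp add: p_def orth if_distrib[of "\<lambda>c. c *\<^sub>R _"] sum.If_cases cong: if_cong)
    then show "e i \<in> V"
      unfolding V_def by (auto intro!: tendsto_eventually eventually_mono[OF eventually_gt_at_top[of i]])
  qed
  ultimately have span: "span (range e) \<subseteq> V"
    by (rule span_minimal[rotated])
  have "(\<lambda>n. p n x) \<longlonglongrightarrow> x"
  proof (rule metric_LIMSEQ_I)
    fix \<epsilon> :: real assume "0 < \<epsilon>"
    then obtain v where "v \<in> span (range e)" and v: "dist v x < \<epsilon> / 3"
      using x closure_approachable[of x "span (range e)"] by (meson divide_pos_pos zero_less_numeral)
    then obtain N where N: "\<And>n. n \<ge> N \<Longrightarrow> dist (p n v) v < \<epsilon> / 3"
      using span \<open>0 < \<epsilon>\<close> metric_LIMSEQ_D[of "\<lambda>n. p n v" v "\<epsilon> / 3"] by (auto simp: V_def)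
    have "dist (p n x) x < \<epsilon>" if "n \<ge> N" for n
    proof -
      have "dist (p n x) (p n v) \<le> dist x v"
        using p_norm[of n "x - v"] by (simp add: p_diff dist_norm)
      with N[OF that] v show ?thesis
        using dist_triangle[of "p n x" x "p n v"] dist_triangle[of "p n v" x v]
        by (simp add: dist_commute)
    qed
    then show "\<exists>N. \<forall>n\<ge>N. dist (p n x) x < \<epsilon>" by blast
  qed
  then have "(\<lambda>n. p n x \<bullet> y) \<longlonglongrightarrow> x \<bullet> y"
    by (intro tendsto_intros)
  then show ?thesis
    by (simp add: sums_def p_inner)
qed

text \<open>The Borel algebra of a product may exceed the product of the Borel algebras when the space is
  not second countable, so joint measurability of the inner product needs one separably valued factor.\<close>

lemma borel_measurable_inner_separable:
  fixes e :: "nat \<Rightarrow> 'a::real_inner"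
  assumes orth: "\<And>i j. e i \<bullet> e j = (if i = j then 1 else 0)"
    and X: "X \<in> borel_measurable M" and Y: "Y \<in> borel_measurable M"
    and span: "\<And>\<omega>. \<omega> \<in> space M \<Longrightarrow> X \<omega> \<in> closure (span (range e))"
  shows "(\<lambda>\<omega>. X \<omega> \<bullet> Y \<omega>) \<in> borel_measurable M"
\<comment> \<open>Each partial sum of the expansion multiplies real functions of \<open>X\<close>
  alone and of \<open>Y\<close> alone, so joint measurability never enters.\<close>
proof (rule borel_measurable_LIMSEQ_real)
  fix \<omega> assume "\<omega> \<in> space M"
  then show "(\<lambda>n. \<Sum>j<n. (X \<omega> \<bullet> e j) * (Y \<omega> \<bullet> e j)) \<longlonglongrightarrow> X \<omega> \<bullet> Y \<omega>"
    using inner_sums_orthonormal[OF orth span] by (simp add: sums_def)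
next
  fix n
  have "(\<lambda>\<omega>. Z \<omega> \<bullet> a) \<in> borel_measurable M" if "Z \<in> borel_measurable M" for Z and a :: 'a
    by (rule borel_measurable_continuous_on[OF _ that]) (intro continuous_intros)
  with X Y show "(\<lambda>\<omega>. \<Sum>j<n. (X \<omega> \<bullet> e j) * (Y \<omega> \<bullet> e j)) \<in> borel_measurable M"
    by (intro borel_measurable_sum borel_measurable_times)
qed

section \<open>Reduction of vector fields to scalar components\<close>

lemma L2_rep_eq: "L2_eq (rep_L2 v) (rep_L2 v)"
  by (rule Quotient3_rep_reflp[OF Quotient3_L2])

lemma L2_eq_rep_abs: "L2_eq f f \<Longrightarrow> L2_eq (rep_L2 (abs_L2 f)) f"
  by (rule rep_abs_rsp_left[OF Quotient3_L2])

text \<open>The basis \<open>e\<close> consists of scalar functions, whereas elements of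
  \<open>\<HH> \<Theta>\<close> are pairs of vector fields. Components turn an inner product of such
  pairs into six scalar ones, to which the expansion in \<open>e\<close> applies.\<close>

lift_definition component_L2 :: "(real ^ 3) L2 \<Rightarrow> 3 \<Rightarrow> real L2" is "\<lambda>f i x. f x $ i"
proof -
  have "sq_integrable (\<lambda>x. f x $ i)" if f: "sq_integrable f" for f :: "real ^ 3 \<Rightarrow> real ^ 3" and i
  proof -
    have [measurable]: "f \<in> borel_measurable lebesgue"
      using f by (simp add: sq_integrable_def)
    have m: "(\<lambda>x. f x $ i) \<in> borel_measurable lebesgue"
      by (rule borel_measurable_continuous_on[of "\<lambda>v. v $ i"]) (auto intro!: continuous_intros)
    have "integrable lebesgue (\<lambda>x. (norm (f x))\<^sup>2)"
      using f by (simp add: sq_integrable_def)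
    then have "integrable lebesgue (\<lambda>x. (norm (f x $ i))\<^sup>2)"
    proof (rule Bochner_Integration.integrable_bound)
      show "(\<lambda>x. (norm (f x $ i))\<^sup>2) \<in> borel_measurable lebesgue" using m by measurable
      show "AE x in lebesgue. norm ((norm (f x $ i))\<^sup>2) \<le> norm ((norm (f x))\<^sup>2)"
        by (rule AE_I2) (simp add: abs_le_square_iff[symmetric] component_le_norm_cart)
    qed
    with m show ?thesis by (simp add: sq_integrable_def)
  qed
  then show "L2_eq f g \<Longrightarrow> L2_eq (\<lambda>x. f x $ i) (\<lambda>x. g x $ i)" for f g :: "real ^ 3 \<Rightarrow> real ^ 3" and i
    by (auto simp: L2_eq_def)
qed

lemma inner_component_L2: "f \<bullet> g = (\<Sum>i\<in>UNIV. component_L2 f i \<bullet> component_L2 g i)"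
proof transfer
  fix f g :: "real ^ 3 \<Rightarrow> real ^ 3"
  assume fg: "L2_eq f f" "L2_eq g g"
  have "L2_eq (\<lambda>x. f x $ i) (\<lambda>x. f x $ i)" "L2_eq (\<lambda>x. g x $ i) (\<lambda>x. g x $ i)" for i
    using fg component_L2.rsp[unfolded rel_fun_def] by blast+
  then have "integrable lebesgue (\<lambda>x. f x $ i * g x $ i)" for i
    using integrable_inner_sq[of "\<lambda>x. f x $ i" "\<lambda>x. g x $ i"] by (simp add: L2_eq_def)
  then show "(LINT x|lebesgue. f x \<bullet> g x) = (\<Sum>i\<in>UNIV. LINT x|lebesgue. f x $ i \<bullet> g x $ i)"
    by (simp add: inner_vec_def)
qed

lemma component_L2_diff: "component_L2 (f - g) i = component_L2 f i - component_L2 g i"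
proof -
  have "component_L2 (f + g) i = component_L2 f i + component_L2 g i" for f g
  proof transfer
    fix f g :: "real ^ 3 \<Rightarrow> real ^ 3" and i
    assume "L2_eq f f" "L2_eq g g"
    then have "L2_eq (\<lambda>x. f x + g x) (\<lambda>x. f x + g x)"
      using sq_integrable_add by (auto simp: L2_eq_def)
    then show "L2_eq (\<lambda>x. (f x + g x) $ i) (\<lambda>x. f x $ i + g x $ i)"
      using component_L2.rsp[unfolded rel_fun_def, rule_format, of "\<lambda>x. f x + g x" "\<lambda>x. f x + g x" i i]
      by simp
  qed
  from this[of "f - g" g] show ?thesis by simp
qed

text \<open>Components are 1-Lipschitz: the squared norm of one is among the nonnegative summands in
  \<open>inner_component_L2\<close>.\<close>

lemma continuous_on_component_L2: "continuous_on UNIV (\<lambda>f. component_L2 f i)"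
proof (rule continuous_onI)
  fix f and \<epsilon> :: real assume "0 < \<epsilon>"
  have "(component_L2 h i) \<bullet> (component_L2 h i) \<le> h \<bullet> h" for h
    unfolding inner_component_L2[of h h]
    by (rule member_le_sum[where f = "\<lambda>i. component_L2 h i \<bullet> component_L2 h i"]) auto
  then have "norm (component_L2 h i) \<le> norm h" for h
    by (simp add: norm_eq_sqrt_inner)
  then have "dist (component_L2 g i) (component_L2 f i) \<le> dist g f" for g
    by (simp add: dist_norm flip: component_L2_diff)
  with \<open>0 < \<epsilon>\<close> show "\<exists>d>0. \<forall>x'\<in>UNIV. dist x' f < d \<longrightarrow> dist (component_L2 x' i) (component_L2 f i) \<le> \<epsilon>"
    by (meson less_le order_trans)
qed

lemma component_L2_in_L2_on:
  assumes "f \<in> L2_on \<Theta>"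
  shows "component_L2 f i \<in> L2_on \<Theta>"
proof -
  have "component_L2 f i = abs_L2 (\<lambda>x. rep_L2 f x $ i)"
    by (simp add: component_L2_def)
  moreover have "L2_eq (\<lambda>x. rep_L2 f x $ i) (\<lambda>x. rep_L2 f x $ i)"
    using component_L2.rsp[unfolded rel_fun_def] L2_rep_eq by blast
  ultimately have "AE x in lebesgue. rep_L2 (component_L2 f i) x = rep_L2 f x $ i"
    using L2_eq_rep_abs by (fastforce simp: L2_eq_def)
  with assms show ?thesis
    by (auto simp: L2_on_def)
qed

text \<open>The asymmetry between \<open>X\<close> and \<open>Y\<close> is deliberate:
  \<open>Y\<close> will also be a limiting noise term, of which only Borel measurability is
  known.\<close>

lemma borel_measurable_inner_HH:
  fixes e :: "nat \<Rightarrow> real L2"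
  assumes e: "orthonormal_basis_of (L2_on \<Theta>) e"
    and X: "X \<in> borel_measurable M" and Y: "Y \<in> borel_measurable M"
    and HH: "\<And>\<omega>. \<omega> \<in> space M \<Longrightarrow> X \<omega> \<in> \<HH> \<Theta>"
  shows "(\<lambda>\<omega>. X \<omega> \<bullet> Y \<omega>) \<in> borel_measurable M"
proof -
  have pr: "(\<lambda>\<omega>. component_L2 (fst (Z \<omega>)) i) \<in> borel_measurable M"
    "(\<lambda>\<omega>. component_L2 (snd (Z \<omega>)) i) \<in> borel_measurable M"
    if "Z \<in> borel_measurable M" for Z :: "_ \<Rightarrow> EM" and i
    by (rule borel_measurable_continuous_on[OF _ that],
        rule continuous_on_compose2[OF continuous_on_component_L2], auto intro!: continuous_intros)+
  have on: "component_L2 (fst (X \<omega>)) i \<in> closure (span (range e))"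
    "component_L2 (snd (X \<omega>)) i \<in> closure (span (range e))" if "\<omega> \<in> space M" for \<omega> i
    using HH[OF that] e component_L2_in_L2_on
    by (auto simp: \<HH>_def orthonormal_basis_of_def mem_Times_iff)
  have orth: "e i \<bullet> e j = (if i = j then 1 else 0)" for i j
    using e by (simp add: orthonormal_basis_of_def)
  have "(\<lambda>\<omega>. (\<Sum>i\<in>UNIV. component_L2 (fst (X \<omega>)) i \<bullet> component_L2 (fst (Y \<omega>)) i) +
      (\<Sum>i\<in>UNIV. component_L2 (snd (X \<omega>)) i \<bullet> component_L2 (snd (Y \<omega>)) i)) \<in> borel_measurable M"
    by (intro borel_measurable_add borel_measurable_sum
        borel_measurable_inner_separable[OF orth] pr X Y on)
  then show ?thesis
    by (simp add: inner_prod_def flip: inner_component_L2)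
qed

text \<open>On the diagonal the inner product is a continuous function of a single variable, so the
  values may lie anywhere.\<close>

lemma borel_measurable_norm_sq:
  fixes Y :: "'w \<Rightarrow> 'a::real_inner"
  assumes "Y \<in> borel_measurable M"
  shows "(\<lambda>\<omega>. Y \<omega> \<bullet> Y \<omega>) \<in> borel_measurable M"
  by (rule borel_measurable_continuous_on[OF _ assms]) (intro continuous_intros)

text \<open>Expanding the products first leaves only vanishing traces, so that linearity of \<open>curl\<close>,
  which rests on the uniqueness of weak curls, is not required.\<close>

lemma Maxwell_skew:
  assumes "u \<in> Maxwell_dom \<Theta>" "v \<in> Maxwell_dom \<Theta>"
  shows "(u - v) \<bullet> (Maxwell \<Theta> u - Maxwell \<Theta> v) = 0"
proof -
  \<comment> \<open>Green's formula without boundary term: \<open>fst a\<close> lies in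
    \<open>H_curl0 \<Theta>\<close> and \<open>snd b\<close> in \<open>H_curl \<Theta>\<close>. Its
    four instances cancel all terms of the expanded product.\<close>
  have "curl \<Theta> (fst a) \<bullet> snd b = fst a \<bullet> curl \<Theta> (snd b)"
    if "a \<in> Maxwell_dom \<Theta>" "b \<in> Maxwell_dom \<Theta>" for a b
    using that by (auto simp: Maxwell_dom_def H_curl0_def tangential_trace_def mem_Times_iff)
  from this[of u u] this[of u v] this[of v u] this[of v v] assms show ?thesis
    by (simp add: Maxwell_def inner_prod_def inner_diff inner_commute)
qed

subsection \<open>Second moments and convergence of the noise\<close>

text \<open>Expanding the square leaves increments multiplied by \<open>N\<close>-measurable
  weights. Assumptions \<open>\<xi>1\<close> and \<open>\<xi>2\<close> say, tested against such
  weights instead of through conditional expectations, that the increments are centred and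
  uncorrelated with variance \<open>\<tau>\<close> given \<open>N\<close>; so only the diagonal
  survives.\<close>

lemma (in prob_space) has_bochner_integral_norm_sq_sum:
  fixes z :: "'a \<Rightarrow> 'b::real_inner" and g :: "nat \<Rightarrow> 'a \<Rightarrow> 'b" and \<xi> :: "nat \<Rightarrow> 'a \<Rightarrow> real"
  assumes N: "subalgebra M N"
    and z: "integrable M (\<lambda>\<omega>. z \<omega> \<bullet> z \<omega>)" and g: "\<And>j. integrable M (\<lambda>\<omega>. g j \<omega> \<bullet> g j \<omega>)"
    and zg: "\<And>j. (\<lambda>\<omega>. z \<omega> \<bullet> g j \<omega>) \<in> borel_measurable N"
    and gg: "\<And>i j. (\<lambda>\<omega>. g i \<omega> \<bullet> g j \<omega>) \<in> borel_measurable N"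
    and \<xi>1: "\<And>X j. X \<in> borel_measurable N \<Longrightarrow> integrable M X \<Longrightarrow>
          has_bochner_integral M (\<lambda>\<omega>. X \<omega> * \<xi> j \<omega>) 0"
    and \<xi>2: "\<And>X i j. X \<in> borel_measurable N \<Longrightarrow> integrable M X \<Longrightarrow>
          has_bochner_integral M (\<lambda>\<omega>. X \<omega> * (\<xi> i \<omega> * \<xi> j \<omega>)) (if i = j then \<tau> * expectation X else 0)"
  shows "has_bochner_integral M (\<lambda>\<omega>. (norm (z \<omega> + (\<Sum>j<n. \<xi> j \<omega> *\<^sub>R g j \<omega>)))\<^sup>2)
           (expectation (\<lambda>\<omega>. z \<omega> \<bullet> z \<omega>) + \<tau> * (\<Sum>j<n. expectation (\<lambda>\<omega>. g j \<omega> \<bullet> g j \<omega>)))"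
proof -
  have int: "integrable M (\<lambda>\<omega>. a \<omega> \<bullet> b \<omega>)"
    if m: "(\<lambda>\<omega>. a \<omega> \<bullet> b \<omega>) \<in> borel_measurable N"
      and ab: "integrable M (\<lambda>\<omega>. a \<omega> \<bullet> a \<omega>)" "integrable M (\<lambda>\<omega>. b \<omega> \<bullet> b \<omega>)" for a b :: "'a \<Rightarrow> 'b"
  proof (rule Bochner_Integration.integrable_bound[OF Bochner_Integration.integrable_add[OF ab]])
    show "(\<lambda>\<omega>. a \<omega> \<bullet> b \<omega>) \<in> borel_measurable M"
      using m N measurable_from_subalg by blast
    have "\<bar>x \<bullet> y\<bar> \<le> x \<bullet> x + y \<bullet> y" for x y :: 'b
      using Cauchy_Schwarz_ineq2[of x y] sum_squares_bound[of "norm x" "norm y"]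
        mult_nonneg_nonneg[of "norm x" "norm y"]
      by (simp add: power2_norm_eq_inner[symmetric])
    then show "AE \<omega> in M. norm (a \<omega> \<bullet> b \<omega>) \<le> norm (a \<omega> \<bullet> a \<omega> + b \<omega> \<bullet> b \<omega>)"
      by (intro AE_I2) (simp add: abs_of_nonneg)
  qed
  let ?S = "\<lambda>\<omega>. z \<omega> \<bullet> z \<omega> + (2 * (\<Sum>j<n. (z \<omega> \<bullet> g j \<omega>) * \<xi> j \<omega>)
      + (\<Sum>i<n. \<Sum>j<n. (g i \<omega> \<bullet> g j \<omega>) * (\<xi> i \<omega> * \<xi> j \<omega>)))"
  have expand: "(norm (z \<omega> + (\<Sum>j<n. \<xi> j \<omega> *\<^sub>R g j \<omega>)))\<^sup>2 = ?S \<omega>" for \<omega>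
  proof -
    define s where "s = (\<Sum>j<n. \<xi> j \<omega> *\<^sub>R g j \<omega>)"
    have "z \<omega> \<bullet> s = (\<Sum>j<n. (z \<omega> \<bullet> g j \<omega>) * \<xi> j \<omega>)"
      unfolding s_def inner_sum_right by (intro sum.cong) simp_all
    moreover have "s \<bullet> s = (\<Sum>i<n. \<Sum>j<n. (g i \<omega> \<bullet> g j \<omega>) * (\<xi> i \<omega> * \<xi> j \<omega>))"
      unfolding s_def inner_sum_right inner_sum_left
      by (subst sum.swap) (intro sum.cong, simp_all)
    moreover have "(norm (z \<omega> + s))\<^sup>2 = z \<omega> \<bullet> z \<omega> + (2 * (z \<omega> \<bullet> s) + s \<bullet> s)"
      by (simp add: power2_norm_eq_inner inner_add_left inner_add_right inner_commute[of s "z \<omega>"])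
    ultimately show ?thesis by (simp only: s_def)
  qed
  have "has_bochner_integral M ?S (expectation (\<lambda>\<omega>. z \<omega> \<bullet> z \<omega>) + (2 * (\<Sum>j<n. 0)
        + (\<Sum>i<n. \<Sum>j<n. if i = j then \<tau> * expectation (\<lambda>\<omega>. g i \<omega> \<bullet> g j \<omega>) else 0)))"
    by (intro has_bochner_integral_add has_bochner_integral_mult_right has_bochner_integral_sum
        has_bochner_integral_integrable[OF z] \<xi>1 \<xi>2 zg gg int[OF zg z g] int[OF gg g g])
  then show ?thesis
    unfolding expand by (simp add: sum_distrib_left)
qed

section \<open>Moments of the Brownian increments against the past\<close>

lemma indep_vars_pair_integral_zero:
  fixes X :: "'i \<Rightarrow> 'w \<Rightarrow> real"
  assumes "prob_space P" "prob_space.indep_vars P (\<lambda>_. borel) X {i, j}" "i \<noteq> j"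
    and "integrable P (X i)" "integrable P (X j)" "integral\<^sup>L P (X j) = 0"
  shows "has_bochner_integral P (\<lambda>\<omega>. X i \<omega> * X j \<omega>) 0"
proof -
  interpret prob_space P by fact
  have int: "integrable P (X k)" if "k \<in> {i, j}" for k using assms that by auto
  from indep_vars_lebesgue_integral[OF _ assms(2) int] indep_vars_integrable[OF _ assms(2) int] assms
  show ?thesis by (simp add: has_bochner_integral_iff)
qed

text \<open>Independence of \<open>X\<close> from the increments factors each integral into the
  expectation of \<open>X\<close> and a moment of the increments. These are the assumptions
  \<open>\<xi>1\<close> and \<open>\<xi>2\<close> of the second-moment formula, with
  \<open>N\<close> the past \<open>\<F> s\<close>.\<close>

lemma Brownian_increment_integrals:
  assumes "prob_space P" and filt: "filtration_on P \<F>" and BM: "independent_Brownian_motions P \<F> \<beta>"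
    and st: "0 \<le> s" "s < t" and X: "X \<in> borel_measurable (\<F> s)" "integrable P X"
  shows "has_bochner_integral P (\<lambda>\<omega>. X \<omega> * (\<beta> j t \<omega> - \<beta> j s \<omega>)) 0"
    and "has_bochner_integral P (\<lambda>\<omega>. X \<omega> * ((\<beta> i t \<omega> - \<beta> i s \<omega>) * (\<beta> j t \<omega> - \<beta> j s \<omega>)))
           (if i = j then (t - s) * integral\<^sup>L P X else 0)"
proof -
  interpret prob_space P by fact
  define \<xi> where "\<xi> j \<omega> = \<beta> j t \<omega> - \<beta> j s \<omega>" for j \<omega>
  have sub: "subalgebra P (\<F> s)" "subalgebra P (\<F> t)"
    using filt st by (auto simp: filtration_on_def)
  have D: "distributed P lborel (\<xi> j) (normal_density 0 (sqrt (t - s)))" for j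
    using BM st unfolding independent_Brownian_motions_def \<xi>_def by blast
  have \<sigma>: "0 < sqrt (t - s)" using st by simp
  have mean: "has_bochner_integral P (\<xi> j) 0" for j
    using normal_distributed_expectation[OF \<sigma> D] distributed_integrable_var[OF D] \<sigma>
      integrable_normal_moment_nz_1[OF \<sigma>] by (simp add: has_bochner_integral_iff)
  have sq: "has_bochner_integral P (\<lambda>\<omega>. \<xi> j \<omega> * \<xi> j \<omega>) (t - s)" for j
  proof -
    have "integrable P (\<lambda>\<omega>. (\<xi> j \<omega>)\<^sup>2)"
      using distributed_integrable[OF D, of "\<lambda>x. x\<^sup>2"] integrable_normal_moment[OF \<sigma>, of 0 2] by simp
    moreover have "expectation (\<lambda>\<omega>. (\<xi> j \<omega>)\<^sup>2) = t - s"
      using normal_distributed_variance[OF \<sigma> D] normal_distributed_expectation[OF \<sigma> D] st by simp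
    ultimately show ?thesis by (simp add: has_bochner_integral_iff power2_eq_square)
  qed
  have cross: "has_bochner_integral P (\<lambda>\<omega>. \<xi> i \<omega> * \<xi> j \<omega>) 0" if "i \<noteq> j" for i j
  proof (rule indep_vars_pair_integral_zero)
    have "indep_vars (\<lambda>_. PiM {0..} (\<lambda>_. borel)) (\<lambda>j \<omega>. \<lambda>t\<in>{0..}. \<beta> j t \<omega>) UNIV"
      using BM unfolding independent_Brownian_motions_def by blast
    \<comment> \<open>Independence of whole paths passes to increments through the measurable map
      \<open>f \<mapsto> f t - f s\<close> on path space.\<close>
    then have "indep_vars (\<lambda>_. borel)
        (\<lambda>j \<omega>. (\<lambda>f. f t - f s) (\<lambda>t\<in>{0..}. \<beta> j t \<omega>)) UNIV"
      by (rule indep_vars_compose2)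
        (use st in \<open>auto intro!: borel_measurable_diff measurable_component_singleton\<close>)
    then have "indep_vars (\<lambda>_. borel) \<xi> UNIV"
      using st by (simp add: \<xi>_def[abs_def])
    then show "indep_vars (\<lambda>_. borel) \<xi> {i, j}"
      by (rule indep_vars_subset) simp
  qed (use that mean in \<open>auto simp: has_bochner_integral_iff prob_space_axioms\<close>)
  \<comment> \<open>The sigma-algebra of all increments jointly: \<open>\<xi> i * \<xi> j\<close> is
    measurable with respect to it, so a single independence statement covers first moments, squares
    and mixed products.\<close>
  define V where "V = vimage_algebra (space P) (\<lambda>\<omega> j. \<xi> j \<omega>) (PiM UNIV (\<lambda>_. borel :: real measure))"
  have ind: "indep_set (sets (\<F> s)) (sets V)"
    using BM st unfolding independent_Brownian_motions_def V_def \<xi>_def by force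
  have \<xi>_V: "\<xi> j \<in> borel_measurable V" for j
  proof -
    have "(\<lambda>\<omega> j. \<xi> j \<omega>) \<in> measurable V (PiM UNIV (\<lambda>_. borel))"
      unfolding V_def by (rule measurable_vimage_algebra1) (auto simp: space_PiM)
    from measurable_compose[OF this measurable_component_singleton[of j]] show ?thesis by simp
  qed
  have product: "has_bochner_integral P (\<lambda>\<omega>. X \<omega> * Z \<omega>) (expectation X * c)"
    if Z: "Z \<in> borel_measurable V" "has_bochner_integral P Z c" for Z c
  proof -
    have m: "sigma_sets (space P) {f -` A \<inter> space P |A. A \<in> sets borel} \<subseteq> sets N"
      if "f \<in> borel_measurable N" "space N = space P" for f :: "_ \<Rightarrow> real" and N
      using that by (intro sets.sigma_sets_subset') (auto dest: measurable_sets simp flip: that(2))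
    have "indep_var borel X borel Z"
      unfolding indep_var_eq
    proof (intro conjI)
      show "random_variable borel X" "random_variable borel Z"
        using X Z by (auto simp: has_bochner_integral_iff)
      have "space (\<F> s) = space P" "space V = space P"
        using sub by (auto simp: subalgebra_def V_def)
      with X Z m show "indep_set (sigma_sets (space P) {X -` A \<inter> space P |A. A \<in> sets borel})
          (sigma_sets (space P) {Z -` A \<inter> space P |A. A \<in> sets borel})"
        using ind unfolding indep_set_def
        by (rule_tac indep_sets_mono_sets[OF ind[unfolded indep_set_def]]) (auto split: bool.split)
    qed
    from indep_var_lebesgue_integral[OF this] indep_var_integrable[OF this] X Z show ?thesis
      by (simp add: has_bochner_integral_iff)
  qed
  from product[OF \<xi>_V mean, of j] show "has_bochner_integral P (\<lambda>\<omega>. X \<omega> * (\<beta> j t \<omega> - \<beta> j s \<omega>)) 0"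
    by (simp add: \<xi>_def)
  have "has_bochner_integral P (\<lambda>\<omega>. \<xi> i \<omega> * \<xi> j \<omega>) (if i = j then t - s else 0)"
    using sq cross by simp
  with \<xi>_V[of i] \<xi>_V[of j]
  have "has_bochner_integral P (\<lambda>\<omega>. X \<omega> * (\<xi> i \<omega> * \<xi> j \<omega>)) (expectation X * (if i = j then t - s else 0))"
    by (intro product borel_measurable_times)
  then show "has_bochner_integral P (\<lambda>\<omega>. X \<omega> * ((\<beta> i t \<omega> - \<beta> i s \<omega>) * (\<beta> j t \<omega> - \<beta> j s \<omega>)))
           (if i = j then (t - s) * integral\<^sup>L P X else 0)"
    by (simp add: \<xi>_def mult.commute split: if_splits)
qed

text \<open>Truncating the distance at 1 turns convergence in probability into convergence in
  \<open>L\<^sup>1\<close>, which has an almost surely convergent subsequence.\<close>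

lemma converges_in_probability_AE_subseq:
  fixes X :: "nat \<Rightarrow> 'w \<Rightarrow> 'a::metric_space"
  assumes "prob_space P" and conv: "converges_in_probability P X Y"
    and m[measurable]: "\<And>n. (\<lambda>\<omega>. dist (X n \<omega>) (Y \<omega>)) \<in> borel_measurable P"
  obtains r :: "nat \<Rightarrow> nat" where "strict_mono r" "AE \<omega> in P. (\<lambda>n. X (r n) \<omega>) \<longlonglongrightarrow> Y \<omega>"
proof -
  interpret prob_space P by fact
  define u where "u n \<omega> = min 1 (dist (X n \<omega>) (Y \<omega>))" for n \<omega>
  have [measurable]: "u n \<in> borel_measurable P" for n
    unfolding u_def by measurable
  have int: "integrable P (u n)" for n
    by (rule integrable_const_bound[of _ 1]) (auto simp: u_def)
  have "(\<lambda>n. \<integral>\<omega>. norm (u n \<omega>) \<partial>P) \<longlonglongrightarrow> 0"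
  proof (rule LIMSEQ_I)
    fix \<epsilon> :: real assume "0 < \<epsilon>"
    define A where "A n = {\<omega> \<in> space P. \<epsilon> / 2 < dist (X n \<omega>) (Y \<omega>)}" for n
    have [measurable]: "A n \<in> sets P" for n
      unfolding A_def by measurable
    have "(\<lambda>n. prob (A n)) \<longlonglongrightarrow> 0"
      using conv \<open>0 < \<epsilon>\<close> unfolding converges_in_probability_def A_def by (meson half_gt_zero)
    then obtain N where N: "\<And>n. n \<ge> N \<Longrightarrow> prob (A n) < \<epsilon> / 2"
      using LIMSEQ_D[of "\<lambda>n. prob (A n)" 0 "\<epsilon> / 2"] \<open>0 < \<epsilon>\<close> by auto
    have "norm ((\<integral>\<omega>. norm (u n \<omega>) \<partial>P) - 0) < \<epsilon>" if "n \<ge> N" for n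
    proof -
      \<comment> \<open>Off \<open>A n\<close> the truncated distance is at most \<epsilon>/2; on
        \<open>A n\<close> it is at most 1.\<close>
      have "(\<integral>\<omega>. norm (u n \<omega>) \<partial>P) \<le> (\<integral>\<omega>. \<epsilon> / 2 + indicator (A n) \<omega> \<partial>P)"
      proof (rule integral_mono)
        show "integrable P (\<lambda>\<omega>. \<epsilon> / 2 + indicator (A n) \<omega>)"
          by (simp add: emeasure_eq_measure)
        show "integrable P (\<lambda>\<omega>. norm (u n \<omega>))" using int by simp
      qed (use \<open>0 < \<epsilon>\<close> in \<open>auto simp: u_def A_def indicator_def\<close>)
      also have "\<dots> = \<epsilon> / 2 + prob (A n)"
        by (simp add: prob_space emeasure_eq_measure)
      finally show ?thesis using N[OF that] by (simp add: u_def)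
    qed
    then show "\<exists>N. \<forall>n\<ge>N. norm ((\<integral>\<omega>. norm (u n \<omega>) \<partial>P) - 0) < \<epsilon>" by blast
  qed
  from tendsto_L1_AE_subseq[OF int this]
  obtain r where r: "strict_mono r" "AE \<omega> in P. (\<lambda>n. u (r n) \<omega>) \<longlonglongrightarrow> 0" by blast
  have "(\<lambda>n. X (r n) \<omega>) \<longlonglongrightarrow> Y \<omega>" if "(\<lambda>n. u (r n) \<omega>) \<longlonglongrightarrow> 0" for \<omega>
  proof -
    \<comment> \<open>Once below 1, the truncation is inactive.\<close>
    have "\<forall>\<^sub>F n in sequentially. u (r n) \<omega> < 1"
      using order_tendstoD(2)[OF that, of 1] by simp
    then have "\<forall>\<^sub>F n in sequentially. u (r n) \<omega> = dist (X (r n) \<omega>) (Y \<omega>)"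
      by (auto simp: u_def elim: eventually_mono)
    with that have "(\<lambda>n. dist (X (r n) \<omega>) (Y \<omega>)) \<longlonglongrightarrow> 0"
      by (simp add: tendsto_cong)
    then show ?thesis by (rule tendsto_dist_iff[THEN iffD2])
  qed
  with r(2) have "AE \<omega> in P. (\<lambda>n. X (r n) \<omega>) \<longlonglongrightarrow> Y \<omega>" by auto
  with r(1) show ?thesis by (rule that)
qed

subsection \<open>Hilbert--Schmidt operators\<close>

lemma subspace_closure:
  fixes S :: "'a::real_normed_vector set"
  assumes "subspace S"
  shows "subspace (closure S)"
  unfolding subspace_def
proof (intro conjI ballI allI)
  show "0 \<in> closure S"
    using subspace_0[OF assms] closure_subset by blast
  fix x c assume "x \<in> closure S"
  then obtain f where f: "\<And>n. f n \<in> S" "f \<longlonglongrightarrow> x"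
    by (auto simp: closure_sequential)
  have "(\<lambda>n. c *\<^sub>R f n) \<longlonglongrightarrow> c *\<^sub>R x" "\<And>n. c *\<^sub>R f n \<in> S"
    using f assms by (auto intro: tendsto_intros subspace_scale)
  then show "c *\<^sub>R x \<in> closure S"
    unfolding closure_sequential by (intro exI[of _ "\<lambda>n. c *\<^sub>R f n"]) auto
  fix y assume "y \<in> closure S"
  then obtain g where g: "\<And>n. g n \<in> S" "g \<longlonglongrightarrow> y"
    by (auto simp: closure_sequential)
  have "(\<lambda>n. f n + g n) \<longlonglongrightarrow> x + y" "\<And>n. f n + g n \<in> S"
    using f g assms by (auto intro: tendsto_intros subspace_add)
  then show "x + y \<in> closure S"
    unfolding closure_sequential by (intro exI[of _ "\<lambda>n. f n + g n"]) auto
qed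

text \<open>Both facts are read off from \<open>V\<close> being the closure of the span of
  \<open>e\<close>; this spares a direct verification for \<open>L2_on \<Theta>\<close>.\<close>

lemma orthonormal_basis_subspace:
  assumes "orthonormal_basis_of V e"
  shows "subspace V" and "e j \<in> V"
proof -
  have V: "V = closure (span (range e))"
    using assms by (simp add: orthonormal_basis_of_def)
  show "subspace V"
    unfolding V by (rule subspace_closure) (rule subspace_span)
  show "e j \<in> V"
    unfolding V by (intro subsetD[OF closure_subset] span_base) simp
qed

text \<open>Linearity of \<open>G\<close> is available only on the range of \<open>R\<close>, so
  each partial sum must first be recognised as the image under \<open>R\<close> of a combination of
  basis vectors.\<close>

lemma HS_sum:
  assumes e: "orthonormal_basis_of (L2_on \<Theta>) e" and R: "symmetric_op_on (L2_on \<Theta>) R"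
    and G: "G \<in> HS \<Theta> R e"
  shows "G (\<Sum>j<n. c j *\<^sub>R R (e j)) = (\<Sum>j<n. c j *\<^sub>R G (R (e j)))"
proof -
  let ?V = "L2_on \<Theta> :: real L2 set"
  have V: "subspace ?V" "\<And>j. e j \<in> ?V"
    using orthonormal_basis_subspace[OF e] by auto
  have R_add: "R (v + w) = R v + R w" and R_scale: "R (r *\<^sub>R v) = r *\<^sub>R R v"
    if "v \<in> ?V" "w \<in> ?V" for v w r
    using R that by (auto simp: symmetric_op_on_def)
  have G_add: "G (v + w) = G v + G w" and G_scale: "G (r *\<^sub>R v) = r *\<^sub>R G v"
    if "v \<in> R ` ?V" "w \<in> R ` ?V" for v w r
    using G that by (auto simp: HS_def U0_def)
  have zero: "R 0 = 0" "0 \<in> ?V"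
    using R_scale[of 0 0 0] subspace_0[OF V(1)] by auto
  have in_V: "(\<Sum>j<n. c j *\<^sub>R e j) \<in> ?V" for n
    by (intro subspace_sum subspace_scale V)
  have R_sum: "R (\<Sum>j<n. c j *\<^sub>R e j) = (\<Sum>j<n. c j *\<^sub>R R (e j))" for n
    by (induction n) (use in_V V zero in \<open>simp_all add: R_add R_scale subspace_scale\<close>)
  have sum_in: "(\<Sum>j<n. c j *\<^sub>R R (e j)) \<in> R ` ?V" for n
    using in_V R_sum[of n] by (metis imageI)
  have term_in: "r *\<^sub>R R (e j) \<in> R ` ?V" for r j
    using V(2)[of j] subspace_scale[OF V(1)] R_scale by (metis imageI)
  show ?thesis
  proof (induction n)
    case 0
    \<comment> \<open>Homogeneity with factor 0 yields \<open>G 0 = 0\<close>, but only after 0 is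
      known to lie in the range.\<close>
    have "(0 :: real L2) \<in> R ` ?V" using zero by (metis imageI)
    from G_scale[OF this this, of 0] show ?case by simp
  next
    case (Suc n)
    then show ?case
      using G_add[OF sum_in[of n] term_in[of "c n" n]] G_scale[of "R (e n)" "R (e n)" "c n"] V(2)[of n]
      by simp
  qed
qed

text \<open>The right side exceeds the left by \<open>(norm (x + y))\<^sup>2\<close>.\<close>

lemma norm_diff_sq_le: "(norm (x - y))\<^sup>2 \<le> 2 * (norm x)\<^sup>2 + 2 * (norm y)\<^sup>2"
  for x y :: "'a::real_inner"
  using inner_ge_zero[of "x + y"]
  by (simp add: power2_norm_eq_inner inner_add inner_diff inner_commute)

text \<open>\<open>HS_norm\<close> is built from \<open>suminf\<close>, which carries information
  only for a summable series. Summability for the difference therefore comes first, from that for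
  \<open>G\<close> and \<open>H\<close>.\<close>

lemma HS_diff_sum_le:
  assumes G: "G \<in> HS \<Theta> R e" and H: "H \<in> HS \<Theta> R e"
    and le: "HS_norm R e (\<lambda>w. G w - H w) \<le> c"
  shows "(\<Sum>j<n. (norm (G (R (e j)) - H (R (e j))))\<^sup>2) \<le> c\<^sup>2"
proof -
  let ?d = "\<lambda>j. (norm (G (R (e j)) - H (R (e j))))\<^sup>2"
  have "summable (\<lambda>j. 2 * (norm (G (R (e j))))\<^sup>2 + 2 * (norm (H (R (e j))))\<^sup>2)"
    using G H by (intro summable_add summable_mult) (auto simp: HS_def)
  then have summable: "summable ?d"
    by (rule summable_comparison_test') (simp add: norm_diff_sq_le)
  have "(\<Sum>j<n. ?d j) \<le> suminf ?d"
    by (rule sum_le_suminf[OF summable]) auto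
  also have "\<dots> = (HS_norm R e (\<lambda>w. G w - H w))\<^sup>2"
    unfolding HS_norm_def by (simp add: suminf_nonneg[OF summable])
  also have "\<dots> \<le> c\<^sup>2"
    using le by (intro power_mono) (auto simp: HS_norm_def suminf_nonneg[OF summable])
  finally show ?thesis .
qed

lemma borel_measurable_norm_diff_sq_HH:
  fixes e :: "nat \<Rightarrow> real L2"
  assumes "orthonormal_basis_of (L2_on \<Theta>) e"
    and "u \<in> borel_measurable M" "v \<in> borel_measurable M" "\<And>\<omega>. \<omega> \<in> space M \<Longrightarrow> u \<omega> \<in> \<HH> \<Theta>"
  shows "(\<lambda>\<omega>. (norm (u \<omega> - v \<omega>))\<^sup>2) \<in> borel_measurable M"
proof -
  have "(\<lambda>\<omega>. u \<omega> \<bullet> u \<omega> - 2 * (u \<omega> \<bullet> v \<omega>) + v \<omega> \<bullet> v \<omega>) \<in> borel_measurable M"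
    by (intro borel_measurable_add borel_measurable_diff borel_measurable_times borel_measurable_const
        borel_measurable_norm_sq borel_measurable_inner_HH[OF assms(1)] assms)
  then show ?thesis
    by (simp add: power2_norm_eq_inner inner_diff inner_commute algebra_simps)
qed

subsection \<open>One step of the scheme\<close>

text \<open>For partial sums of the noise the second moment is explicit, and the Hilbert-Schmidt
  bound controls it uniformly in their length. Nonnegative integrals let Fatou's lemma pass to the
  limit before its integrability is known.\<close>

lemma noise_term_second_moment:
  fixes B :: "EM \<Rightarrow> real L2 \<Rightarrow> EM"
  assumes "prob_space P" and filt: "filtration_on P \<F>" and BM: "independent_Brownian_motions P \<F> \<beta>"
    and e: "orthonormal_basis_of (L2_on \<Theta>) e" and R: "symmetric_op_on (L2_on \<Theta>) R"
    and st: "0 \<le> s" "s < t"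
    and u: "u \<in> borel_measurable (\<F> s)" "\<And>\<omega>. \<omega> \<in> space P \<Longrightarrow> u \<omega> \<in> \<HH> \<Theta>"
    and v: "v \<in> borel_measurable (\<F> s)" "\<And>\<omega>. \<omega> \<in> space P \<Longrightarrow> v \<omega> \<in> \<HH> \<Theta>"
    and HS: "\<And>h. h \<in> \<HH> \<Theta> \<Longrightarrow> B h \<in> HS \<Theta> R e"
    and Lip: "\<And>h h'. h \<in> \<HH> \<Theta> \<Longrightarrow> h' \<in> \<HH> \<Theta> \<Longrightarrow>
           HS_norm R e (\<lambda>w. B h w - B h' w) \<le> L * norm (h - h')"
    and Y: "noise_term P R e \<beta> s t (\<lambda>\<omega>. B (u \<omega>)) Y"
    and Y': "noise_term P R e \<beta> s t (\<lambda>\<omega>. B (v \<omega>)) Y'"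
    and int: "integrable P (\<lambda>\<omega>. (norm (u \<omega> - v \<omega>))\<^sup>2)"
  shows "(\<integral>\<^sup>+\<omega>. ennreal ((norm (u \<omega> - v \<omega> + (Y \<omega> - Y' \<omega>)))\<^sup>2) \<partial>P)
    \<le> ennreal ((1 + L\<^sup>2 * (t - s)) * (\<integral>\<omega>. (norm (u \<omega> - v \<omega>))\<^sup>2 \<partial>P))"
proof -
  interpret prob_space P by fact
  have sub: "subalgebra P (\<F> s)" "subalgebra P (\<F> t)" "sets (\<F> s) \<subseteq> sets (\<F> t)"
    using filt st by (auto simp: filtration_on_def)
  have space: "space (\<F> s) = space P"
    using sub by (simp add: subalgebra_def)
  define \<xi> where "\<xi> j \<omega> = \<beta> j t \<omega> - \<beta> j s \<omega>" for j \<omega>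
  have \<xi>: "\<xi> j \<in> borel_measurable P" for j
  proof -
    have "\<beta> j t \<in> borel_measurable P" "\<beta> j s \<in> borel_measurable P"
      using BM st sub measurable_from_subalg unfolding independent_Brownian_motions_def
      by (meson less_imp_le order_trans)+
    then show ?thesis unfolding \<xi>_def by measurable
  qed
  define b where "b j h = B h (R (e j))" for j h
  have b_HH: "b j h \<in> \<HH> \<Theta>" if "h \<in> \<HH> \<Theta>" for j h
    using HS[OF that] orthonormal_basis_subspace(2)[OF e] by (auto simp: HS_def U0_def b_def)
  have b_sum: "(\<Sum>j<n. (norm (b j h - b j h'))\<^sup>2) \<le> L\<^sup>2 * (norm (h - h'))\<^sup>2"
    if "h \<in> \<HH> \<Theta>" "h' \<in> \<HH> \<Theta>" for n h h'
    using HS_diff_sum_le[OF HS HS Lip, of h h'] that by (simp add: b_def power_mult_distrib)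
  \<comment> \<open>The absolute value is there because \<open>L\<close> has no prescribed sign and
    \<open>lipschitz_on\<close> demands a nonnegative constant.\<close>
  have b_Lip: "norm (b j h - b j h') \<le> \<bar>L\<bar> * norm (h - h')"
    if "h \<in> \<HH> \<Theta>" "h' \<in> \<HH> \<Theta>" for j h h'
  proof -
    have "(norm (b j h - b j h'))\<^sup>2 \<le> (\<Sum>j<Suc j. (norm (b j h - b j h'))\<^sup>2)"
      by (rule member_le_sum) auto
    also have "\<dots> \<le> (\<bar>L\<bar> * norm (h - h'))\<^sup>2"
      using b_sum[OF that, of "Suc j"] by (simp only: power_mult_distrib power2_abs)
    finally show ?thesis by (rule power2_le_imp_le) simp
  qed
  \<comment> \<open>Measurability of the noise coefficients comes from Lipschitz continuity on
    \<open>\<HH> \<Theta>\<close>, where all values of \<open>w\<close> lie.\<close>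
  have b_meas: "(\<lambda>\<omega>. b j (w \<omega>)) \<in> borel_measurable (\<F> s)"
    if w: "w \<in> borel_measurable (\<F> s)" "\<And>\<omega>. \<omega> \<in> space P \<Longrightarrow> w \<omega> \<in> \<HH> \<Theta>" for j w
  proof -
    have "\<bar>L\<bar>-lipschitz_on (\<HH> \<Theta>) (b j)"
      using b_Lip by (intro lipschitz_onI) (auto simp: dist_norm)
    then have "b j \<in> borel_measurable (restrict_space borel (\<HH> \<Theta>))"
      by (intro borel_measurable_continuous_on_restrict lipschitz_on_continuous_on)
    moreover have "w \<in> measurable (\<F> s) (restrict_space borel (\<HH> \<Theta>))"
      using w space by (intro measurable_restrict_space2) auto
    ultimately show ?thesis by (rule measurable_compose[rotated])
  qed
  note fromF = measurable_from_subalg[OF sub(1)]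
  define z where "z \<omega> = u \<omega> - v \<omega>" for \<omega>
  define g where "g j \<omega> = b j (u \<omega>) - b j (v \<omega>)" for j \<omega>
  note inner_meas = borel_measurable_inner_HH[OF e]
  \<comment> \<open>Differences are multiplied out first: each resulting inner product has factors
    with values in \<open>\<HH> \<Theta>\<close>.\<close>
  have zg: "(\<lambda>\<omega>. z \<omega> \<bullet> g j \<omega>) \<in> borel_measurable (\<F> s)"
    and gg: "(\<lambda>\<omega>. g i \<omega> \<bullet> g j \<omega>) \<in> borel_measurable (\<F> s)" for i j
    unfolding z_def g_def inner_diff_left inner_diff_right
    by (intro borel_measurable_diff inner_meas b_meas b_HH u v; use u v space in simp)+
  have z_int: "integrable P (\<lambda>\<omega>. z \<omega> \<bullet> z \<omega>)"
    using int by (simp add: z_def power2_norm_eq_inner)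
  have g_sum: "(\<Sum>j<n. g j \<omega> \<bullet> g j \<omega>) \<le> L\<^sup>2 * (z \<omega> \<bullet> z \<omega>)" if "\<omega> \<in> space P" for n \<omega>
    using b_sum[OF u(2)[OF that] v(2)[OF that]] by (simp add: g_def z_def power2_norm_eq_inner)
  have g_int: "integrable P (\<lambda>\<omega>. g j \<omega> \<bullet> g j \<omega>)" for j
  proof (rule Bochner_Integration.integrable_bound)
    show "integrable P (\<lambda>\<omega>. L\<^sup>2 * (z \<omega> \<bullet> z \<omega>))" using z_int by simp
    show "AE \<omega> in P. norm (g j \<omega> \<bullet> g j \<omega>) \<le> norm (L\<^sup>2 * (z \<omega> \<bullet> z \<omega>))"
    proof (rule AE_I2)
      fix \<omega> assume "\<omega> \<in> space P"
      have "g j \<omega> \<bullet> g j \<omega> \<le> (\<Sum>j<Suc j. g j \<omega> \<bullet> g j \<omega>)"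
        by (rule member_le_sum) auto
      with g_sum[OF \<open>\<omega> \<in> space P\<close>, of "Suc j"]
      show "norm (g j \<omega> \<bullet> g j \<omega>) \<le> norm (L\<^sup>2 * (z \<omega> \<bullet> z \<omega>))" by simp
    qed
  qed (rule fromF[OF gg])
  define E where "E = (\<integral>\<omega>. (norm (u \<omega> - v \<omega>))\<^sup>2 \<partial>P)"
  have E_eq: "E = expectation (\<lambda>\<omega>. z \<omega> \<bullet> z \<omega>)"
    by (simp add: E_def z_def power2_norm_eq_inner)
  define S where "S n \<omega> = z \<omega> + (\<Sum>j<n. \<xi> j \<omega> *\<^sub>R g j \<omega>)" for n \<omega>
  have S: "has_bochner_integral P (\<lambda>\<omega>. (norm (S n \<omega>))\<^sup>2)
      (E + (t - s) * (\<Sum>j<n. expectation (\<lambda>\<omega>. g j \<omega> \<bullet> g j \<omega>)))" for n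
    unfolding S_def E_eq
    by (rule has_bochner_integral_norm_sq_sum[OF sub(1) z_int g_int zg gg])
      (unfold \<xi>_def, rule Brownian_increment_integrals(1)[OF \<open>prob_space P\<close> filt BM st],
        assumption+, rule Brownian_increment_integrals(2)[OF \<open>prob_space P\<close> filt BM st])
  have S_le: "(\<integral>\<^sup>+\<omega>. ennreal ((norm (S n \<omega>))\<^sup>2) \<partial>P) \<le> ennreal ((1 + L\<^sup>2 * (t - s)) * E)" for n
  proof -
    have "(\<Sum>j<n. expectation (\<lambda>\<omega>. g j \<omega> \<bullet> g j \<omega>)) = expectation (\<lambda>\<omega>. \<Sum>j<n. g j \<omega> \<bullet> g j \<omega>)"
      by (rule Bochner_Integration.integral_sum[symmetric]) (rule g_int)
    also have "\<dots> \<le> expectation (\<lambda>\<omega>. L\<^sup>2 * (z \<omega> \<bullet> z \<omega>))"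
      by (rule integral_mono) (use g_int z_int g_sum in auto)
    also have "\<dots> = L\<^sup>2 * E" by (simp add: E_eq)
    finally have "E + (t - s) * (\<Sum>j<n. expectation (\<lambda>\<omega>. g j \<omega> \<bullet> g j \<omega>)) \<le> E + (t - s) * (L\<^sup>2 * E)"
      using st by (intro add_left_mono mult_left_mono) auto
    with S[of n] show ?thesis
      by (subst nn_integral_eq_integral)
        (auto simp: has_bochner_integral_iff algebra_simps intro!: ennreal_leI)
  qed
  \<comment> \<open>Stated along a given subsequence \<open>q\<close>, so that a second application,
    to \<open>Y'\<close>, refines the subsequence already chosen for \<open>Y\<close>.\<close>
  have conv: "\<exists>r. strict_mono r \<and> (AE \<omega> in P. (\<lambda>n. \<Sum>j<q (r n). \<xi> j \<omega> *\<^sub>R b j (w \<omega>)) \<longlonglongrightarrow> Z \<omega>)"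
    if w: "w \<in> borel_measurable (\<F> s)" "\<And>\<omega>. \<omega> \<in> space P \<Longrightarrow> w \<omega> \<in> \<HH> \<Theta>"
      and Z: "noise_term P R e \<beta> s t (\<lambda>\<omega>. B (w \<omega>)) Z" and q: "strict_mono q"
    for w Z and q :: "nat \<Rightarrow> nat"
  proof -
    let ?G = "\<lambda>n \<omega>. B (w \<omega>) (\<Sum>j<n. \<xi> j \<omega> *\<^sub>R R (e j))"
    have G_eq: "?G n \<omega> = (\<Sum>j<n. \<xi> j \<omega> *\<^sub>R b j (w \<omega>))" if "\<omega> \<in> space P" for n \<omega>
      using HS_sum[OF e R HS] w(2)[OF that] by (simp add: b_def)
    have Zm: "Z \<in> borel_measurable P" and cp: "converges_in_probability P ?G Z"
      using Z by (auto simp: noise_term_def \<xi>_def)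
    have cp': "converges_in_probability P (\<lambda>n. ?G (q n)) Z"
      using cp LIMSEQ_subseq_LIMSEQ[OF _ q] unfolding converges_in_probability_def comp_def by fastforce
    \<comment> \<open>not automatic, and needed: \<open>measure\<close> is \<open>0\<close> on non-measurable sets\<close>
    have m: "(\<lambda>\<omega>. dist (?G n \<omega>) (Z \<omega>)) \<in> borel_measurable P" for n
    proof -
      \<comment> \<open>The squared distance multiplied out, so that only real-valued measurable
        functions occur.\<close>
      let ?s = "\<lambda>\<omega>. (\<Sum>i<n. \<Sum>j<n. \<xi> i \<omega> * (\<xi> j \<omega> * (b i (w \<omega>) \<bullet> b j (w \<omega>))))
        - 2 * (\<Sum>j<n. \<xi> j \<omega> * (b j (w \<omega>) \<bullet> Z \<omega>)) + Z \<omega> \<bullet> Z \<omega>"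
      have "?s \<in> borel_measurable P"
        by (intro borel_measurable_add borel_measurable_diff borel_measurable_sum
            borel_measurable_times borel_measurable_const \<xi> borel_measurable_norm_sq Zm
            inner_meas fromF[OF b_meas] b_HH w)
      then have "(\<lambda>\<omega>. sqrt (?s \<omega>)) \<in> borel_measurable P"
        by measurable
      moreover have "dist (?G n \<omega>) (Z \<omega>) = sqrt (?s \<omega>)" if "\<omega> \<in> space P" for \<omega>
      proof -
        define a where "a = (\<Sum>j<n. \<xi> j \<omega> *\<^sub>R b j (w \<omega>))"
        have "a \<bullet> a = (\<Sum>i<n. \<Sum>j<n. \<xi> i \<omega> * (\<xi> j \<omega> * (b i (w \<omega>) \<bullet> b j (w \<omega>))))"
          unfolding a_def inner_sum_right inner_sum_left
          by (subst sum.swap) (intro sum.cong, simp_all)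
        moreover have "a \<bullet> Z \<omega> = (\<Sum>j<n. \<xi> j \<omega> * (b j (w \<omega>) \<bullet> Z \<omega>))"
          by (simp add: a_def inner_sum_left)
        moreover have "dist a (Z \<omega>) = sqrt (a \<bullet> a - 2 * (a \<bullet> Z \<omega>) + Z \<omega> \<bullet> Z \<omega>)"
          by (simp add: dist_norm norm_eq_sqrt_inner inner_diff inner_commute[of "Z \<omega>" a])
        ultimately show ?thesis
          by (simp only: G_eq[OF that] a_def)
      qed
      ultimately show ?thesis
        by (simp cong: measurable_cong)
    qed
    obtain r :: "nat \<Rightarrow> nat" where r: "strict_mono r" "AE \<omega> in P. (\<lambda>n. ?G (q (r n)) \<omega>) \<longlonglongrightarrow> Z \<omega>"
      using converges_in_probability_AE_subseq[OF \<open>prob_space P\<close> cp' m] by blast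
    have "AE \<omega> in P. (\<lambda>n. \<Sum>j<q (r n). \<xi> j \<omega> *\<^sub>R b j (w \<omega>)) \<longlonglongrightarrow> Z \<omega>"
      using r(2) AE_space by eventually_elim (simp add: G_eq)
    with r(1) show ?thesis by blast
  qed
  obtain r :: "nat \<Rightarrow> nat" where r: "strict_mono r"
    "AE \<omega> in P. (\<lambda>n. \<Sum>j<r n. \<xi> j \<omega> *\<^sub>R b j (u \<omega>)) \<longlonglongrightarrow> Y \<omega>"
    using conv[OF u Y strict_mono_id] by auto
  obtain r' :: "nat \<Rightarrow> nat" where r': "strict_mono r'"
    "AE \<omega> in P. (\<lambda>n. \<Sum>j<r (r' n). \<xi> j \<omega> *\<^sub>R b j (v \<omega>)) \<longlonglongrightarrow> Y' \<omega>"
    using conv[OF v Y' r(1)] by auto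
  \<comment> \<open>Along the common subsequence \<open>S\<close> converges almost surely; writing
    its limit as a \<open>liminf\<close> prepares Fatou's lemma.\<close>
  have "AE \<omega> in P. ennreal ((norm (z \<omega> + (Y \<omega> - Y' \<omega>)))\<^sup>2)
      = liminf (\<lambda>n. ennreal ((norm (S (r (r' n)) \<omega>))\<^sup>2))"
    using r(2) r'(2)
  proof eventually_elim
    case (elim \<omega>)
    have "(\<lambda>n. \<Sum>j<r (r' n). \<xi> j \<omega> *\<^sub>R b j (u \<omega>)) \<longlonglongrightarrow> Y \<omega>"
      using LIMSEQ_subseq_LIMSEQ[OF elim(1) r'(1)] by (simp add: comp_def)
    from tendsto_diff[OF this elim(2)]
    have "(\<lambda>n. \<Sum>j<r (r' n). \<xi> j \<omega> *\<^sub>R g j \<omega>) \<longlonglongrightarrow> Y \<omega> - Y' \<omega>"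
      by (simp add: g_def scaleR_diff_right sum_subtractf)
    then have "(\<lambda>n. ennreal ((norm (S (r (r' n)) \<omega>))\<^sup>2)) \<longlonglongrightarrow> ennreal ((norm (z \<omega> + (Y \<omega> - Y' \<omega>)))\<^sup>2)"
      unfolding S_def by (intro tendsto_intros)
    then show ?case
      by (rule lim_imp_Liminf[OF sequentially_bot, symmetric])
  qed
  then have "(\<integral>\<^sup>+\<omega>. ennreal ((norm (z \<omega> + (Y \<omega> - Y' \<omega>)))\<^sup>2) \<partial>P)
      = (\<integral>\<^sup>+\<omega>. liminf (\<lambda>n. ennreal ((norm (S (r (r' n)) \<omega>))\<^sup>2)) \<partial>P)"
    by (rule nn_integral_cong_AE)
  also have "\<dots> \<le> liminf (\<lambda>n. \<integral>\<^sup>+\<omega>. ennreal ((norm (S (r (r' n)) \<omega>))\<^sup>2) \<partial>P)"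
    using S by (intro nn_integral_liminf) (auto simp: has_bochner_integral_iff)
  also have "\<dots> \<le> ennreal ((1 + L\<^sup>2 * (t - s)) * E)"
    by (rule Liminf_le) (simp_all add: S_le)
  finally show ?thesis by (simp add: z_def E_def)
qed

text \<open>Testing the step with \<open>y\<close> removes \<open>m\<close>, and the implicit terms
  contribute the factor \<open>1 + (\<sigma> - \<alpha>) * h\<close> in front of
  \<open>(norm y)\<^sup>2\<close>. Cauchy-Schwarz and division by \<open>norm y\<close> give the
  bound before squaring.\<close>

lemma implicit_step_bound:
  fixes x y m f d :: "'a::real_inner"
  assumes step: "y - x = h *\<^sub>R m - (\<sigma> * h) *\<^sub>R y + h *\<^sub>R f + d"
    and "y \<bullet> m = 0" "y \<bullet> f \<le> \<alpha> * (norm y)\<^sup>2" "0 < h" "\<alpha> < \<sigma>"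
  shows "(1 + (\<sigma> - \<alpha>) * h)\<^sup>2 * (norm y)\<^sup>2 \<le> (norm (x + d))\<^sup>2"
proof -
  have "h * (y \<bullet> f) \<le> h * (\<alpha> * (norm y)\<^sup>2)"
    using assms by (intro mult_left_mono) auto
  moreover have "y \<bullet> (y - x) = - (\<sigma> * h) * (norm y)\<^sup>2 + h * (y \<bullet> f) + y \<bullet> d"
    unfolding step using assms(2) by (simp add: inner_add_right inner_diff_right power2_norm_eq_inner)
  ultimately have "(1 + (\<sigma> - \<alpha>) * h) * (norm y)\<^sup>2 \<le> y \<bullet> (x + d)"
    by (simp add: inner_add_right inner_diff_right power2_norm_eq_inner algebra_simps)
  also have "\<dots> \<le> norm y * norm (x + d)"
    by (rule norm_cauchy_schwarz)
  finally have "(1 + (\<sigma> - \<alpha>) * h) * norm y \<le> norm (x + d)"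
    by (cases "y = 0") (auto simp: power2_eq_square mult_ac)
  with assms(4,5) have "((1 + (\<sigma> - \<alpha>) * h) * norm y)\<^sup>2 \<le> (norm (x + d))\<^sup>2"
    by (intro power_mono) auto
  then show ?thesis by (simp add: power_mult_distrib)
qed

text \<open>Compare \<open>1 + b * h\<close> with \<open>exp (b * h)\<close> and split off
  \<open>exp (a * h)\<close>, which is at most \<open>(1 + a * h)\<^sup>2\<close> for
  \<open>a * h\<close> in the unit interval. This is where smallness of the step enters.\<close>

lemma one_plus_le_exp_mult:
  fixes a b h :: real
  assumes "0 < a" "0 \<le> h" "h * a \<le> 1"
  shows "1 + b * h \<le> (1 + a * h)\<^sup>2 * exp (- (a - b) * h)"
proof -
  have "exp (a * h) \<le> 1 + a * h + (a * h)\<^sup>2"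
    using assms by (intro exp_bound) (auto simp: mult.commute)
  also have "\<dots> \<le> (1 + a * h)\<^sup>2"
    using assms by (simp add: power2_eq_square algebra_simps)
  finally have "exp (a * h) * exp (- (a - b) * h) \<le> (1 + a * h)\<^sup>2 * exp (- (a - b) * h)"
    by (intro mult_right_mono) auto
  moreover have "exp (a * h) * exp (- (a - b) * h) = exp (b * h)"
    by (simp flip: exp_add add: algebra_simps)
  ultimately show ?thesis
    using exp_ge_add_one_self[of "b * h"] by linarith
qed

section \<open>Mean-square contraction by induction over the time steps\<close>

theorem corollary3p3:
  fixes \<Theta> :: "(real ^ 3) set"
    and P :: "'w measure" and \<F> :: "real \<Rightarrow> 'w measure"
    and Q Qhalf :: "real L2 \<Rightarrow> real L2" and e :: "nat \<Rightarrow> real L2"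
    and \<beta> :: "nat \<Rightarrow> real \<Rightarrow> 'w \<Rightarrow> real"
    and Je Jm Jer Jmr :: "real ^ 3 \<Rightarrow> real ^ 3 \<Rightarrow> real ^ 3 \<Rightarrow> real ^ 3"
    and F :: "EM \<Rightarrow> EM" and B :: "EM \<Rightarrow> real L2 \<Rightarrow> EM"
    and \<sigma>\<^sub>0 \<alpha>F \<alpha>B :: real
    and u0 u0' :: "'w \<Rightarrow> EM"
  assumes "open \<Theta>" and "connected \<Theta>" and "bounded \<Theta>" and "\<Theta> \<noteq> {}"
    and "prob_space P" and "filtration_on P \<F>"
    and "pos_def_op_on (L2_on \<Theta>) Q" and "is_sqrt_op_on (L2_on \<Theta>) Q Qhalf"
    and "orthonormal_basis_of (L2_on \<Theta>) e"
    and "independent_Brownian_motions P \<F> \<beta>"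
    and "F = Nemytskij_F \<Theta> Je Jm" and "F_well_defined \<Theta> Je Jm"
    and "B = Nemytskij_B \<Theta> Jer Jmr" and "B_well_defined \<Theta> Qhalf e Jer Jmr"
    and "L2_initial P \<F> \<Theta> u0" and "L2_initial P \<F> \<Theta> u0'"
    and "\<And>u v. u \<in> \<HH> \<Theta> \<Longrightarrow> v \<in> \<HH> \<Theta> \<Longrightarrow> (u - v) \<bullet> (F u - F v) \<le> \<alpha>F * (norm (u - v))\<^sup>2"
    and "\<And>u v. u \<in> \<HH> \<Theta> \<Longrightarrow> v \<in> \<HH> \<Theta> \<Longrightarrow>
           HS_norm Qhalf e (\<lambda>w. B u w - B v w) \<le> \<alpha>B * norm (u - v)"
    and "\<sigma>\<^sub>0 > \<alpha>F + \<alpha>B\<^sup>2"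
  shows "\<exists>\<delta>>0. \<forall>\<Delta>t. 0 < \<Delta>t \<and> \<Delta>t < \<delta> \<longrightarrow>
           (\<forall>u u'. Euler_solution P \<F> Qhalf e \<beta> \<Theta> F B \<sigma>\<^sub>0 \<Delta>t u0 u \<longrightarrow>
                   Euler_solution P \<F> Qhalf e \<beta> \<Theta> F B \<sigma>\<^sub>0 \<Delta>t u0' u' \<longrightarrow>
              (\<forall>k\<ge>1. (\<integral>\<^sup>+\<omega>. ennreal ((norm (u k \<omega> - u' k \<omega>))\<^sup>2) \<partial>P)
                 \<le> ennreal (exp (- (\<sigma>\<^sub>0 - \<alpha>F - \<alpha>B\<^sup>2) * real k * \<Delta>t))
                    * (\<integral>\<^sup>+\<omega>. ennreal ((norm (u0 \<omega> - u0' \<omega>))\<^sup>2) \<partial>P)))"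
proof -
  interpret prob_space P by fact
  note filt = assms(6) and e = assms(9) and BM = assms(10) and well_B = assms(13,14)
  note F_mono = assms(17) and B_Lip = assms(18)
  have R: "symmetric_op_on (L2_on \<Theta>) Qhalf"
    using assms(8) by (simp add: is_sqrt_op_on_def)
  have HS: "B h \<in> HS \<Theta> Qhalf e" if "h \<in> \<HH> \<Theta>" for h
    using well_B that by (simp add: B_well_defined_def)
  define a where "a = \<sigma>\<^sub>0 - \<alpha>F"
  have a: "0 < a" unfolding a_def using assms(19) zero_le_power2[of \<alpha>B] by linarith
  show ?thesis
  \<comment> \<open>The threshold \<open>1 / a\<close> ensures \<open>a * \<Delta>t \<le> 1\<close>,
    as \<open>one_plus_le_exp_mult\<close> requires.\<close>
  proof (intro exI[of _ "1 / a"] conjI allI impI)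
    show "0 < 1 / a" using a by simp
    fix \<Delta>t and u u' :: "nat \<Rightarrow> 'w \<Rightarrow> EM" and k :: nat
    assume "0 < \<Delta>t \<and> \<Delta>t < 1 / a" and "1 \<le> k"
      and u: "Euler_solution P \<F> Qhalf e \<beta> \<Theta> F B \<sigma>\<^sub>0 \<Delta>t u0 u"
      and u': "Euler_solution P \<F> Qhalf e \<beta> \<Theta> F B \<sigma>\<^sub>0 \<Delta>t u0' u'"
    then have t: "0 < \<Delta>t" "\<Delta>t * a \<le> 1"
      using a by (auto simp: field_simps)
    define I where "I k = (\<integral>\<^sup>+\<omega>. ennreal ((norm (u k \<omega> - u' k \<omega>))\<^sup>2) \<partial>P)" for k
    define I0 where "I0 = (\<integral>\<^sup>+\<omega>. ennreal ((norm (u0 \<omega> - u0' \<omega>))\<^sup>2) \<partial>P)"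
    \<comment> \<open>\<open>c\<close> is the gain of the implicit step and \<open>\<rho>\<close>
      the target contraction factor; \<open>c_le\<close> says that \<open>c\<close> absorbs the
      growth due to the noise.\<close>
    define c where "c = (1 + a * \<Delta>t)\<^sup>2"
    define \<rho> where "\<rho> = exp (- (a - \<alpha>B\<^sup>2) * \<Delta>t)"
    have c: "0 < c"
      unfolding c_def using a t by (intro zero_less_power add_pos_pos) auto
    have c_le: "1 + \<alpha>B\<^sup>2 * \<Delta>t \<le> c * \<rho>"
      unfolding c_def \<rho>_def using a t by (intro one_plus_le_exp_mult) auto
    have adapted: "u k \<in> borel_measurable (\<F> (real k * \<Delta>t))" "u' k \<in> borel_measurable (\<F> (real k * \<Delta>t))"
      and HH: "\<And>\<omega>. \<omega> \<in> space P \<Longrightarrow> u k \<omega> \<in> \<HH> \<Theta>" "\<And>\<omega>. \<omega> \<in> space P \<Longrightarrow> u' k \<omega> \<in> \<HH> \<Theta>" for k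
      using u u' by (auto simp: Euler_solution_def)
    have sub: "subalgebra P (\<F> (real k * \<Delta>t))" for k
      using filt t by (simp add: filtration_on_def)
    have meas: "(\<lambda>\<omega>. (norm (u k \<omega> - u' k \<omega>))\<^sup>2) \<in> borel_measurable P" for k
      by (rule borel_measurable_norm_diff_sq_HH[OF e])
        (use adapted measurable_from_subalg[OF sub] HH in blast)+
    have I0_finite: "I0 < \<infinity>"
    proof -
      have "I0 \<le> (\<integral>\<^sup>+\<omega>. ennreal (2 * (norm (u0 \<omega>))\<^sup>2 + 2 * (norm (u0' \<omega>))\<^sup>2) \<partial>P)"
        unfolding I0_def by (intro nn_integral_mono ennreal_leI norm_diff_sq_le)
      also have "\<dots> < \<infinity>"
        using assms(15,16) by (subst nn_integral_eq_integral) (auto simp: L2_initial_def)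
      finally show ?thesis .
    qed
    \<comment> \<open>Finiteness of \<open>I k\<close> makes the squared difference integrable, as
      the second-moment estimate requires.\<close>
    have step: "I (Suc k) \<le> ennreal \<rho> * I k" if "I k < \<infinity>" for k
    proof -
      let ?s = "real k * \<Delta>t" and ?t = "real (Suc k) * \<Delta>t"
      obtain Y where Y: "noise_term P Qhalf e \<beta> ?s ?t (\<lambda>\<omega>. B (u k \<omega>)) Y"
        and uY: "AE \<omega> in P. u (Suc k) \<omega> \<in> Maxwell_dom \<Theta> \<and> u (Suc k) \<omega> - u k \<omega> =
          \<Delta>t *\<^sub>R Maxwell \<Theta> (u (Suc k) \<omega>) - (\<sigma>\<^sub>0 * \<Delta>t) *\<^sub>R u (Suc k) \<omega> + \<Delta>t *\<^sub>R F (u (Suc k) \<omega>) + Y \<omega>"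
        using u unfolding Euler_solution_def by blast
      obtain Y' where Y': "noise_term P Qhalf e \<beta> ?s ?t (\<lambda>\<omega>. B (u' k \<omega>)) Y'"
        and uY': "AE \<omega> in P. u' (Suc k) \<omega> \<in> Maxwell_dom \<Theta> \<and> u' (Suc k) \<omega> - u' k \<omega> =
          \<Delta>t *\<^sub>R Maxwell \<Theta> (u' (Suc k) \<omega>) - (\<sigma>\<^sub>0 * \<Delta>t) *\<^sub>R u' (Suc k) \<omega> + \<Delta>t *\<^sub>R F (u' (Suc k) \<omega>) + Y' \<omega>"
        using u' unfolding Euler_solution_def by blast
      have int: "integrable P (\<lambda>\<omega>. (norm (u k \<omega> - u' k \<omega>))\<^sup>2)"
        using that meas by (intro integrableI_nonneg) (auto simp: I_def)
      let ?E = "\<integral>\<omega>. (norm (u k \<omega> - u' k \<omega>))\<^sup>2 \<partial>P"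
      have I_eq: "I k = ennreal ?E"
        unfolding I_def by (rule nn_integral_eq_integral[OF int]) simp
      have "AE \<omega> in P. ennreal c * ennreal ((norm (u (Suc k) \<omega> - u' (Suc k) \<omega>))\<^sup>2)
          \<le> ennreal ((norm (u k \<omega> - u' k \<omega> + (Y \<omega> - Y' \<omega>)))\<^sup>2)"
        \<comment> \<open>\<open>AE_space\<close> supplies membership of the values in
          \<open>\<HH> \<Theta>\<close>, needed for the monotonicity of \<open>F\<close>.\<close>
        using uY uY' AE_space
      proof eventually_elim
        case (elim \<omega>)
        let ?v = "u (Suc k) \<omega>" and ?v' = "u' (Suc k) \<omega>"
        have "(1 + (\<sigma>\<^sub>0 - \<alpha>F) * \<Delta>t)\<^sup>2 * (norm (?v - ?v'))\<^sup>2 \<le> (norm (u k \<omega> - u' k \<omega> + (Y \<omega> - Y' \<omega>)))\<^sup>2"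
        proof (rule implicit_step_bound)
          have "(?v - ?v') - (u k \<omega> - u' k \<omega>) = (?v - u k \<omega>) - (?v' - u' k \<omega>)" by simp
          also have "\<dots> = \<Delta>t *\<^sub>R (Maxwell \<Theta> ?v - Maxwell \<Theta> ?v') - (\<sigma>\<^sub>0 * \<Delta>t) *\<^sub>R (?v - ?v')
              + \<Delta>t *\<^sub>R (F ?v - F ?v') + (Y \<omega> - Y' \<omega>)"
            using elim by (simp add: scaleR_diff_right)
          finally show "(?v - ?v') - (u k \<omega> - u' k \<omega>) = \<dots>" .
          show "(?v - ?v') \<bullet> (Maxwell \<Theta> ?v - Maxwell \<Theta> ?v') = 0"
            using elim by (simp add: Maxwell_skew)
          show "(?v - ?v') \<bullet> (F ?v - F ?v') \<le> \<alpha>F * (norm (?v - ?v'))\<^sup>2"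
            using elim HH by (intro F_mono) auto
        qed (use t a in \<open>simp_all add: a_def\<close>)
        then show ?case
          using c by (simp add: c_def a_def flip: ennreal_mult)
      qed
      then have "(\<integral>\<^sup>+\<omega>. ennreal c * ennreal ((norm (u (Suc k) \<omega> - u' (Suc k) \<omega>))\<^sup>2) \<partial>P)
          \<le> (\<integral>\<^sup>+\<omega>. ennreal ((norm (u k \<omega> - u' k \<omega> + (Y \<omega> - Y' \<omega>)))\<^sup>2) \<partial>P)"
        by (rule nn_integral_mono_AE)
      then have "ennreal c * I (Suc k) \<le> (\<integral>\<^sup>+\<omega>. ennreal ((norm (u k \<omega> - u' k \<omega> + (Y \<omega> - Y' \<omega>)))\<^sup>2) \<partial>P)"
        using meas[of "Suc k"] by (simp add: I_def nn_integral_cmult)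
      also have "\<dots> \<le> ennreal ((1 + \<alpha>B\<^sup>2 * (?t - ?s)) * ?E)"
        by (rule noise_term_second_moment[OF prob_space_axioms filt BM e R _ _
            adapted(1) HH(1) adapted(2) HH(2) HS B_Lip Y Y' int]) (use t in auto)
      also have "\<dots> \<le> ennreal (c * \<rho> * ?E)"
        using c_le by (intro ennreal_leI mult_right_mono) (auto simp: algebra_simps)
      also have "\<dots> = ennreal c * (ennreal \<rho> * I k)"
        using c by (simp add: I_eq ennreal_mult \<rho>_def mult.assoc)
      finally show ?thesis
        \<comment> \<open>Cancelling \<open>ennreal c\<close> is legitimate because \<open>c\<close>
          is positive and finite.\<close>
        using c by (subst (asm) ennreal_mult_le_mult_iff) auto
    qed
    have "I k \<le> ennreal (exp (- (a - \<alpha>B\<^sup>2) * real k * \<Delta>t)) * I0" for k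
    proof (induction k)
      case 0
      \<comment> \<open>Both schemes attain their initial data only almost surely.\<close>
      have "AE \<omega> in P. ennreal ((norm (u 0 \<omega> - u' 0 \<omega>))\<^sup>2) = ennreal ((norm (u0 \<omega> - u0' \<omega>))\<^sup>2)"
        using u u' by (auto simp: Euler_solution_def)
      then have "I 0 = I0"
        unfolding I_def I0_def by (rule nn_integral_cong_AE)
      then show ?case by simp
    next
      case (Suc k)
      \<comment> \<open>The induction hypothesis also propagates finiteness from \<open>I0\<close>,
        which licenses the next step.\<close>
      have "I k < \<infinity>"
        using Suc by (rule le_less_trans) (use I0_finite in \<open>simp add: ennreal_mult_less_top\<close>)
      then have "I (Suc k) \<le> ennreal \<rho> * I k"
        by (rule step)
      also have "\<dots> \<le> ennreal \<rho> * (ennreal (exp (- (a - \<alpha>B\<^sup>2) * real k * \<Delta>t)) * I0)"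
        using Suc by (rule mult_left_mono) simp
      also have "\<dots> = ennreal (\<rho> * exp (- (a - \<alpha>B\<^sup>2) * real k * \<Delta>t)) * I0"
        by (simp add: ennreal_mult \<rho>_def mult.assoc)
      also have "\<rho> * exp (- (a - \<alpha>B\<^sup>2) * real k * \<Delta>t) = exp (- (a - \<alpha>B\<^sup>2) * real (Suc k) * \<Delta>t)"
        unfolding \<rho>_def exp_add[symmetric] by (simp add: algebra_simps)
      finally show ?case .
    qed
    then show "(\<integral>\<^sup>+\<omega>. ennreal ((norm (u k \<omega> - u' k \<omega>))\<^sup>2) \<partial>P)
        \<le> ennreal (exp (- (\<sigma>\<^sub>0 - \<alpha>F - \<alpha>B\<^sup>2) * real k * \<Delta>t))
          * (\<integral>\<^sup>+\<omega>. ennreal ((norm (u0 \<omega> - u0' \<omega>))\<^sup>2) \<partial>P)"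
      by (simp add: I_def I0_def a_def)
  qed
qed

end
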